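(* Let $G$ be a connected graph. Then $G$ is $[2,3]$-choosable if and only if the core of $G$ belongs (up to isomorphism) to $$\widetilde T=\{K_1\}\cup\{C_{2m+2} : m\geq 1\}\cup\{\theta_{2,2,2m}: m\geq 1\}\cup\{K_{2,m+3}: m\geq 1\}.$$
   Context: All graphs are finite and simple. A graph $G=(V,E)$ is $[\ell,k]$-choosable (with $k\ge \ell$) if for every assignment $L$ of lists $L(v)\subseteq\{1,\dots,k\}$ with $|L(v)|=\ell$ for all $v\in V$, there is a proper coloring $c$ of $G$ (that is, $c(u)\ne c(v)$ for every edge $uv$) with $c(v)\in L(v)$ for all $v\in V$. The lists need not use all colors of $\{1,\dots,k\}$. The core of a graph is the subgraph obtained by repeatedly removing a vertex of degree $1$ together with its incident edge until the graph contains only isolated vertices and vertices of degree at least $2$. $K_1$ is the one-vertex graph, $C_q$ is the cycle on $q$ vertices, $K_{p,q}$ is the complete bipartite graph with parts of sizes $p$ and $q$. For positive integers $a,b,c$, $\theta_{a,b,c}$ is the graph consisting of three internally vertex-disjoint paths of lengths (numbers of edges) $a,b,c$ between two fixed distinct vertices. *)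

theory Defs
  imports "Graph_Theory.Kuratowski" "Graph_Theory.Digraph_Isomorphism"
begin

text \<open>
  A finite simple graph is a \<^locale>\<open>graph\<close> of the AFP entry Graph_Theory, that is, a finite
  symmetric digraph without loops and parallel arcs: an edge \<open>uv\<close> is the pair of opposite arcs
  \<open>(u,v)\<close>, \<open>(v,u)\<close>, so the degree of \<open>v\<close> is \<^term>\<open>out_degree G v\<close>.
  Connected graphs are nonempty.
\<close>

definition proper_coloring :: "('a,'b) pre_digraph \<Rightarrow> ('a \<Rightarrow> nat) \<Rightarrow> bool" where
  "proper_coloring G c \<longleftrightarrow> (\<forall>(u,v) \<in> arcs_ends G. c u \<noteq> c v)"

definition lk_choosable :: "nat \<Rightarrow> nat \<Rightarrow> ('a,'b) pre_digraph \<Rightarrow> bool" where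
  "lk_choosable l k G \<longleftrightarrow>
     (\<forall>L :: 'a \<Rightarrow> nat set.
        (\<forall>v \<in> verts G. L v \<subseteq> {1..k} \<and> card (L v) = l) \<longrightarrow>
        (\<exists>c. proper_coloring G c \<and> (\<forall>v \<in> verts G. c v \<in> L v)))"

definition remove_leaf :: "('a,'b) pre_digraph \<Rightarrow> ('a,'b) pre_digraph \<Rightarrow> bool" where
  "remove_leaf G G' \<longleftrightarrow>
     (\<exists>v \<in> verts G. out_degree G v = 1 \<and> G' = pre_digraph.del_vert G v)"

text \<open>
  A relation, since the result depends on the order of removals: any vertex of a tree can be
  the one that remains. Up to isomorphism the core is unique.
\<close>

definition is_core :: "('a,'b) pre_digraph \<Rightarrow> ('a,'b) pre_digraph \<Rightarrow> bool" where
  "is_core G H \<longleftrightarrow>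
     remove_leaf\<^sup>*\<^sup>* G H \<and> (\<forall>v \<in> verts H. out_degree H v = 0 \<or> out_degree H v \<ge> 2)"

lemma is_core_exists:
  assumes "finite (verts G)"
  shows "\<exists>H. is_core G H"
  using assms
proof (induction "card (verts G)" arbitrary: G rule: less_induct)
  case less
  show ?case
  proof (cases "\<exists>v \<in> verts G. out_degree G v = 1")
    case True
    then obtain v where v: "v \<in> verts G" "out_degree G v = 1" by blast
    let ?G' = "pre_digraph.del_vert G v"
    have "remove_leaf G ?G'" using v by (auto simp: remove_leaf_def)
    moreover have "card (verts ?G') < card (verts G)" "finite (verts ?G')"
      using v less.prems card_Diff1_less[of "verts G" v]
      by (simp_all add: pre_digraph.verts_del_vert del: card_Diff_singleton)
    with less.hyps obtain H where "is_core ?G' H" by blast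
    ultimately have "is_core G H"
      by (auto simp: is_core_def intro: converse_rtranclp_into_rtranclp)
    then show ?thesis by blast
  next
    case False
    then have "is_core G G"
      by (force simp: is_core_def)
    then show ?thesis by blast
  qed
qed

text \<open>The cycle on \<open>q\<close> vertices, for \<open>q \<ge> 3\<close>.\<close>

definition cycle_graph :: "nat \<Rightarrow> nat pair_pre_digraph" where
  "cycle_graph q =
     \<lparr> pverts = {..<q},
       parcs = {(i,j). i < q \<and> j < q \<and> (j = Suc i mod q \<or> i = Suc j mod q)} \<rparr>"

text \<open>
  In a theta graph, \<open>theta_path i l j\<close> is the vertex at distance \<open>j\<close> from the first end along the
  path number \<open>i\<close>, which has length \<open>l\<close>. At most one length may be \<open>1\<close>: paths of length \<open>1\<close>
  coincide.
\<close>

datatype theta_vertex = End1 | End2 | Inner nat nat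

definition theta_path :: "nat \<Rightarrow> nat \<Rightarrow> nat \<Rightarrow> theta_vertex" where
  "theta_path i l j = (if j = 0 then End1 else if j = l then End2 else Inner i j)"

definition theta_path_arcs :: "nat \<Rightarrow> nat \<Rightarrow> theta_vertex rel" where
  "theta_path_arcs i l = (\<Union>j<l. {(theta_path i l j, theta_path i l (Suc j)),
                                   (theta_path i l (Suc j), theta_path i l j)})"

definition theta_graph :: "nat \<Rightarrow> nat \<Rightarrow> nat \<Rightarrow> theta_vertex pair_pre_digraph" where
  "theta_graph a b c =
     \<lparr> pverts = theta_path 0 a ` {..a} \<union> theta_path 1 b ` {..b} \<union> theta_path 2 c ` {..c},
       parcs = theta_path_arcs 0 a \<union> theta_path_arcs 1 b \<union> theta_path_arcs 2 c \<rparr>"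

lemma pair_graph_cycle_graph:
  assumes "q \<ge> 3"
  shows "pair_graph (cycle_graph q)"
proof
  have "finite ({..<q} \<times> {..<q})" by simp
  then show "finite (parcs (cycle_graph q))"
    by (rule rev_finite_subset) (auto simp: cycle_graph_def)
  show "fst e \<noteq> snd e" if "e \<in> parcs (cycle_graph q)" for e
    using that assms by (auto simp: cycle_graph_def mod_Suc split: if_splits)
qed (auto simp: cycle_graph_def symmetric_def intro: symI)

lemma pair_graph_theta_graph:
  assumes "a > 0" "b > 0" "c > 0"
  shows "pair_graph (theta_graph a b c)"
proof
  show "fst e \<noteq> snd e" if "e \<in> parcs (theta_graph a b c)" for e
    using that assms by (auto simp: theta_graph_def theta_path_arcs_def theta_path_def split: if_splits)
  have sym: "sym (theta_path_arcs i l)" for i l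
    by (auto simp: theta_path_arcs_def intro!: symI)
  show "symmetric (with_proj (theta_graph a b c))"
    by (auto simp: theta_graph_def symmetric_def intro!: sym_Un sym)
qed (auto simp: theta_graph_def theta_path_arcs_def)

text \<open>
  Membership, up to isomorphism, in the family of the theorem.
  \<open>K\<^bsub>n\<^esub>\<close> and \<open>K\<^bsub>p,q\<^esub>\<close> are isomorphism-invariant predicates of Graph_Theory.
\<close>

definition in_T_tilde :: "('a,'b) pre_digraph \<Rightarrow> bool" where
  "in_T_tilde H \<longleftrightarrow>
     K\<^bsub>1\<^esub> H \<or>
     (\<exists>m\<ge>1. digraph_iso H (with_proj (cycle_graph (2 * m + 2)))) \<or>
     (\<exists>m\<ge>1. digraph_iso H (with_proj (theta_graph 2 2 (2 * m)))) \<or>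
     (\<exists>m\<ge>1. K\<^bsub>2,m + 3\<^esub> H)"

end

theory Submission
  imports Defs
begin

text \<open>
  Lists \<open>{d\<^sub>0, d\<^sub>1}, {d\<^sub>1, d\<^sub>2}, \<dots>\<close> along a path propagate the colour \<open>d\<^sub>0\<close> of its first end and
  thereby forbid one chosen pair of end colours. Forbidding enough pairs along internally disjoint
  paths shows that a choosable graph contains no odd cycle, no two cycles sharing just one vertex
  or joined by a path, no theta graph other than \<open>\<theta>\<^bsub>2,2,2m\<^esub>\<close>, and no \<open>\<theta>\<^bsub>2,2,2m\<^esub>\<close> with a third path of
  length 2 if \<open>m \<ge> 2\<close>. As the core has minimum degree 2, a cycle that is not the whole core has an
  ear and so extends to some \<open>\<theta>\<^bsub>2,2,2m\<^esub>\<close>; checking where a further ear can be attached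
  shows that the core equals it if \<open>m \<ge> 2\<close>, and is a \<open>K\<^bsub>2,n\<^esub>\<close> if \<open>m = 1\<close>.

  Conversely, along a path whose lists are not all equal, some colour of the first end is
  compatible with every colour of the last one. This colours even cycles and \<open>\<theta>\<^bsub>2,2,2m\<^esub>\<close>; in \<open>K\<^bsub>2,n\<^esub>\<close>
  the two lists of the small side, being pairs out of three colours, have a common colour.
\<close>

section \<open>Blocking colours along paths\<close>

text \<open>A bare vertex set and edge relation turn vertex deletion and relabelling into set
  operations; \<open>lk_choosable_2_3_iff\<close> gives the link to digraphs.\<close>

definition choosable23 :: "'a set \<Rightarrow> 'a rel \<Rightarrow> bool" where
  "choosable23 V E \<longleftrightarrow>
     (\<forall>L. (\<forall>v\<in>V. L v \<subseteq> {1..3} \<and> card (L v) = 2) \<longrightarrow>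
        (\<exists>c::'a \<Rightarrow> nat. (\<forall>(u,v)\<in>E. c u \<noteq> c v) \<and> (\<forall>v\<in>V. c v \<in> L v)))"

text \<open>Lists matter on \<open>U\<close> only, while \<open>P\<close> usually concerns the
  colours of path ends, which may lie outside \<open>U\<close>. This makes blockings by disjoint
  paths independent of each other. The list of a vertex is itself a blocking: it excludes all other
  colours.\<close>

definition blocked :: "'a rel \<Rightarrow> 'a set \<Rightarrow> (('a \<Rightarrow> nat) \<Rightarrow> bool) \<Rightarrow> bool" where
  "blocked E U P \<longleftrightarrow>
     (\<exists>L. (\<forall>v. L v \<subseteq> {1..3} \<and> card (L v) = 2) \<and>
        (\<forall>c. (\<forall>(u,v)\<in>E. c u \<noteq> c v) \<and> (\<forall>v\<in>U. c v \<in> L v) \<longrightarrow> \<not> P c))"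

lemma blocked_not_choosable:
  assumes "blocked E U (\<lambda>_. True)" "U \<subseteq> V"
  shows "\<not> choosable23 V E"
proof
  assume ch: "choosable23 V E"
  obtain L where L: "\<forall>v. L v \<subseteq> {1..3::nat} \<and> card (L v) = 2"
    "\<And>c. \<lbrakk>\<forall>(u,v)\<in>E. c u \<noteq> c v; \<forall>v\<in>U. c v \<in> L v\<rbrakk> \<Longrightarrow> False"
    using assms(1) unfolding blocked_def by blast
  obtain c where "\<forall>(u,v)\<in>E. c u \<noteq> c v" "\<forall>v\<in>V. c v \<in> L v"
    using ch[unfolded choosable23_def, rule_format, of L] L(1) by blast
  then show False using L(2)[of c] assms(2) by blast
qed

lemma blocked_mono:
  assumes "blocked E U P" and QP: "\<And>c. \<forall>(u,v)\<in>E. c u \<noteq> c v \<Longrightarrow> Q c \<Longrightarrow> P c"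
  shows "blocked E U Q"
proof -
  obtain L where L: "\<forall>v. L v \<subseteq> {1..3::nat} \<and> card (L v) = 2"
    "\<And>c. \<lbrakk>\<forall>(u,v)\<in>E. c u \<noteq> c v; \<forall>v\<in>U. c v \<in> L v\<rbrakk> \<Longrightarrow> \<not> P c"
    using assms(1) unfolding blocked_def by auto
  have "\<not> Q c" if "\<forall>(u,v)\<in>E. c u \<noteq> c v" "\<forall>v\<in>U. c v \<in> L v" for c
    using L(2)[OF that] QP[OF that(1)] by (rule contrapos_nn)
  then show ?thesis
    unfolding blocked_def using L(1) by (intro exI[of _ L]) simp
qed

text \<open>On disjoint sets the two list assignments can be merged. Excluded conditions are
  collected in this way until their disjunction is always true, which refutes choosability by
  \<open>blocked_not_choosable\<close>.\<close>

lemma blocked_Un: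
  assumes "blocked E U P" "blocked E W Q" "U \<inter> W = {}"
  shows "blocked E (U \<union> W) (\<lambda>c. P c \<or> Q c)"
proof -
  obtain L where L: "\<forall>v. L v \<subseteq> {1..3::nat} \<and> card (L v) = 2"
    "\<And>c. \<lbrakk>\<forall>(u,v)\<in>E. c u \<noteq> c v; \<forall>v\<in>U. c v \<in> L v\<rbrakk> \<Longrightarrow> \<not> P c"
    using assms(1) unfolding blocked_def by blast
  obtain M where M: "\<forall>v. M v \<subseteq> {1..3::nat} \<and> card (M v) = 2"
    "\<And>c. \<lbrakk>\<forall>(u,v)\<in>E. c u \<noteq> c v; \<forall>v\<in>W. c v \<in> M v\<rbrakk> \<Longrightarrow> \<not> Q c"
    using assms(2) unfolding blocked_def by blast
  let ?N = "\<lambda>v. if v \<in> U then L v else M v"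
  have "\<not> (P c \<or> Q c)"
    if c: "\<forall>(u,v)\<in>E. c u \<noteq> c v" and "\<forall>v\<in>U \<union> W. c v \<in> ?N v" for c
  proof -
    have "\<forall>v\<in>U. c v \<in> L v" using that(2) by (metis UnI1)
    moreover have "\<forall>v\<in>W. c v \<in> M v"
      using that(2) assms(3) by (metis UnI2 disjoint_iff)
    ultimately show ?thesis using L(2) M(2) c by blast
  qed
  then show ?thesis
    unfolding blocked_def using L(1) M(1) by (intro exI[of _ ?N]) auto
qed

lemma blocked_vertex:
  assumes "a \<in> {1..3}" "b \<in> {1..3}" "a \<noteq> b"
  shows "blocked E {x} (\<lambda>c. c x \<noteq> a \<and> c x \<noteq> b)"
  unfolding blocked_def using assms by (intro exI[of _ "\<lambda>_. {a, b}"]) auto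

text \<open>Only the inner vertices are in the list: the ends then keep lists of their own, and
  equal ends describe a cycle. The number of edges is one more than the length of the list.\<close>

fun seg_edges :: "'a \<Rightarrow> 'a list \<Rightarrow> 'a \<Rightarrow> 'a rel" where
  "seg_edges u [] v = {(u, v), (v, u)}"
| "seg_edges u (x # xs) v = {(u, x), (x, u)} \<union> seg_edges x xs v"

lemma seg_edges_append:
  "seg_edges u (xs @ y # ys) v = seg_edges u xs y \<union> seg_edges y ys v"
  by (induction xs arbitrary: u) auto

lemma seg_edges_rev: "seg_edges v (rev xs) u = seg_edges u xs v"
  by (induction xs arbitrary: u) (auto simp: seg_edges_append)

lemma UN_lessThan_Suc_shift: "(\<Union>j<Suc n. f j) = f 0 \<union> (\<Union>j<n. f (Suc j))"
  by (simp add: lessThan_Suc_eq_insert_0)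

lemma seg_edges_nth:
  "seg_edges u ps v =
     (\<Union>j<Suc (length ps). {((u # ps @ [v]) ! j, (u # ps @ [v]) ! Suc j),
                            ((u # ps @ [v]) ! Suc j, (u # ps @ [v]) ! j)})"
proof (induction ps arbitrary: u)
  case (Cons x xs)
  show ?case
    unfolding seg_edges.simps Cons.IH by (simp only: UN_lessThan_Suc_shift list.size add_Suc_right
      append_Cons nth_Cons_0 nth_Cons_Suc add_0_right)
qed auto

lemma ex_third_color: "\<exists>d\<in>{1..3::nat}. d \<noteq> a \<and> d \<noteq> b"
proof -
  have "\<not> {1..3} \<subseteq> {a, b}"
  proof
    assume "{1..3} \<subseteq> {a, b}"
    then have "card {1..3::nat} \<le> card {a, b}" by (intro card_mono) auto
    then show False by (simp add: card_insert_if split: if_splits)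
  qed
  then show ?thesis by blast
qed

text \<open>
  A pair of end colours is blocked as soon as it is joined by a walk in the triangle on the
  colours that is one step shorter than the path.
\<close>

lemma blocked_seg:
  assumes "seg_edges u ps v \<subseteq> E" "distinct ps" "a \<in> {1..3}" "b \<in> {1..3}"
    "length ps = 0 \<Longrightarrow> a = b" "length ps = 1 \<Longrightarrow> a \<noteq> b"
  shows "blocked E (set ps) (\<lambda>c. c u = a \<and> c v = b)"
  using assms
proof (induction ps arbitrary: u a)
  case Nil
  then show ?case
    unfolding blocked_def by (intro exI[of _ "\<lambda>_. {1, 2}"]) auto
next
  case (Cons x xs)
  \<comment> \<open>With the list \<open>{a, d}\<close> at \<open>x\<close>, colour \<open>a\<close>
    at \<open>u\<close> forces \<open>d\<close> at \<open>x\<close>, so the pair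
    \<open>(d, b)\<close> remains to be blocked on the rest of the path. The last two conditions on
    \<open>d\<close> are what the induction hypothesis demands of a rest with at most one
    vertex.\<close>
  obtain d where d: "d \<in> {1..3}" "d \<noteq> a" "length xs = 0 \<longrightarrow> d = b" "length xs = 1 \<longrightarrow> d \<noteq> b"
  proof (cases "length xs = 0")
    case True
    then show ?thesis using that[of b] Cons.prems by auto
  next
    case False
    then show ?thesis using that ex_third_color[of a b] by auto
  qed
  have set: "set (x # xs) = {x} \<union> set xs" by simp
  have b: "blocked E ({x} \<union> set xs) (\<lambda>c. c x \<noteq> a \<and> c x \<noteq> d \<or> c x = d \<and> c v = b)"
    using Cons.prems d by (intro blocked_Un blocked_vertex Cons.IH) auto
  show ?case
    unfolding set by (rule blocked_mono[OF b]) (use Cons.prems in auto)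
qed

text \<open>With the same list \<open>{a, b}\<close> at every inner vertex, the two colours
  alternate along the path once an end has one of them. So one path blocks two pairs at once; parity
  decides which.\<close>

lemma blocked_seg_const:
  assumes "seg_edges u ps v \<subseteq> E" "distinct ps" "a \<in> {1..3}" "b \<in> {1..3}" "a \<noteq> b"
  shows "blocked E (set ps)
    (\<lambda>c. if even (length ps) then c u = a \<and> c v = a \<or> c u = b \<and> c v = b
         else c u = a \<and> c v = b \<or> c u = b \<and> c v = a)"
  using assms
proof (induction ps arbitrary: u)
  case Nil
  then show ?case
    unfolding blocked_def by (intro exI[of _ "\<lambda>_. {1, 2}"]) auto
next
  case (Cons x xs)
  have set: "set (x # xs) = {x} \<union> set xs" by simp
  have b: "blocked E ({x} \<union> set xs) (\<lambda>c. (c x \<noteq> a \<and> c x \<noteq> b) \<or>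
     (if even (length xs) then c x = a \<and> c v = a \<or> c x = b \<and> c v = b
         else c x = a \<and> c v = b \<or> c x = b \<and> c v = a))"
    using Cons.prems by (intro blocked_Un blocked_vertex Cons.IH) auto
  show ?case
    unfolding set by (rule blocked_mono[OF b]) (use Cons.prems in \<open>auto split: if_splits\<close>)
qed

section \<open>Cycles and forbidden subgraphs\<close>

definition cyc :: "'a rel \<Rightarrow> 'a \<Rightarrow> 'a list \<Rightarrow> bool" where
  "cyc E x A \<longleftrightarrow> seg_edges x A x \<subseteq> E \<and> distinct (x # A) \<and> 2 \<le> length A"

lemma cyc_rotate:
  assumes "cyc E x (A @ y # B)"
  shows "cyc E y (B @ x # A)"
  using assms by (auto simp: cyc_def seg_edges_append)

text \<open>A cycle is a path from \<open>x\<close> to \<open>x\<close> with at least two inner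
  vertices, and such a path can block any pair, here \<open>(a, a)\<close>.\<close>

lemma blocked_cyc:
  assumes "cyc E x A" "a \<in> {1..3}"
  shows "blocked E (set A) (\<lambda>c. c x = a)"
  using blocked_seg[of x A x E a a] assms by (auto simp: cyc_def)

locale simple_graph =
  fixes V :: "'a set" and E :: "'a rel"
  assumes finite_V: "finite V"
    and E_subset: "E \<subseteq> V \<times> V"
    and sym_E: "sym E"
    and irrefl_E: "irrefl E"
begin

lemma seg_edges_in_V:
  assumes "seg_edges u ps v \<subseteq> E"
  shows "u \<in> V" "v \<in> V" "set ps \<subseteq> V"
proof -
  have "u \<in> V \<and> v \<in> V \<and> set ps \<subseteq> V"
    using assms E_subset by (induction ps arbitrary: u) auto
  then show "u \<in> V" "v \<in> V" "set ps \<subseteq> V" by auto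
qed

text \<open>\<open>A\<close> omits \<open>x\<close>, so an even length means an odd cycle; with the
  list \<open>{1, 2}\<close> everywhere, alternation fails at \<open>x\<close>.\<close>

lemma choosable_cyc_odd:
  assumes "choosable23 V E" "cyc E x A"
  shows "odd (length A)"
proof (rule ccontr)
  assume even: "\<not> odd (length A)"
  have b: "blocked E ({x} \<union> set A) (\<lambda>c. c x \<noteq> 1 \<and> c x \<noteq> 2 \<or>
    (if even (length A) then c x = 1 \<and> c x = 1 \<or> c x = 2 \<and> c x = 2
         else c x = 1 \<and> c x = 2 \<or> c x = 2 \<and> c x = 1))"
    using assms(2) by (intro blocked_Un blocked_vertex blocked_seg_const) (auto simp: cyc_def)
  have "blocked E ({x} \<union> set A) (\<lambda>_. True)"
    by (rule blocked_mono[OF b]) (use even in auto)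
  moreover have "{x} \<union> set A \<subseteq> V"
    using assms(2) seg_edges_in_V[of x A x] by (auto simp: cyc_def)
  ultimately show False using assms(1) blocked_not_choosable by blast
qed

lemma cyc_in_V: "cyc E x A \<Longrightarrow> insert x (set A) \<subseteq> V"
  using seg_edges_in_V[of x A x] by (auto simp: cyc_def)

text \<open>With the list \<open>{1, 2}\<close> at \<open>x\<close>, one cycle excludes colour 1 and
  the other colour 2.\<close>

lemma two_cycs_not_choosable:
  assumes "cyc E x A" "cyc E x B" "set A \<inter> set B = {}"
  shows "\<not> choosable23 V E"
proof -
  have b: "blocked E ({x} \<union> (set A \<union> set B)) (\<lambda>c. (c x \<noteq> 1 \<and> c x \<noteq> 2) \<or> (c x = 1 \<or> c x = 2))"
    using assms by (intro blocked_Un blocked_vertex blocked_cyc) (auto simp: cyc_def)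
  have "blocked E ({x} \<union> (set A \<union> set B)) (\<lambda>_. True)"
    by (rule blocked_mono[OF b]) auto
  then show ?thesis
    by (rule blocked_not_choosable) (use cyc_in_V assms in blast)
qed

text \<open>The cycles exclude colour 1 at \<open>x\<close> and at \<open>y\<close>, which leaves
  one colour of each list, and the connecting path blocks this last pair.\<close>

lemma two_cycs_tail_not_choosable:
  assumes "cyc E x A" "seg_edges x T y \<subseteq> E" "cyc E y B"
    "distinct (x # A @ T @ y # B)"
  shows "\<not> choosable23 V E"
proof -
  \<comment> \<open>An edge blocks only equal pairs and a path with one inner vertex only unequal
    ones; this choice makes \<open>(2, b)\<close> blockable for every \<open>T\<close>.\<close>
  define b :: nat where "b = (if T = [] then 2 else 3)"
  have b: "blocked E ({x} \<union> set A \<union> ({y} \<union> set B) \<union> set T)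
     (\<lambda>c. ((c x \<noteq> 1 \<and> c x \<noteq> 2 \<or> c x = 1) \<or> (c y \<noteq> 1 \<and> c y \<noteq> b \<or> c y = 1)) \<or> (c x = 2 \<and> c y = b))"
    using assms by (intro blocked_Un blocked_vertex blocked_cyc blocked_seg) (auto simp: cyc_def b_def)
  have "blocked E ({x} \<union> set A \<union> ({y} \<union> set B) \<union> set T) (\<lambda>_. True)"
    by (rule blocked_mono[OF b]) auto
  then show ?thesis
    by (rule blocked_not_choosable) (use cyc_in_V assms seg_edges_in_V(3)[of x T y] in blast)
qed

text \<open>Any two of the paths form a cycle, so all three have lengths of the same parity. If two
  of them had at least two inner vertices each, lists \<open>{1, 2}\<close> at both ends would leave
  four pairs: the third path blocks two of them by constant lists, the long ones block one
  each.\<close>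

lemma choosable_theta:
  assumes ch: "choosable23 V E" and "u \<noteq> v"
    and segs: "seg_edges u A v \<subseteq> E" "seg_edges u B v \<subseteq> E" "seg_edges u C v \<subseteq> E"
    and dist: "distinct (u # v # A @ B @ C)" and ne: "B \<noteq> []" "C \<noteq> []"
  shows "odd (length A) \<and> odd (length B) \<and> odd (length C) \<and>
    (length A = 1 \<and> length B = 1 \<or> length A = 1 \<and> length C = 1 \<or> length B = 1 \<and> length C = 1)"
proof -
  have cyc: "cyc E u (X @ v # rev Y)"
    if "seg_edges u X v \<subseteq> E" "seg_edges u Y v \<subseteq> E" "distinct (u # v # X @ Y)" "Y \<noteq> []" for X Y
    using that by (auto simp: cyc_def seg_edges_append seg_edges_rev Suc_le_eq)
  have "odd (length (A @ v # rev B))" "odd (length (A @ v # rev C))"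
    using segs dist ne by (auto intro!: choosable_cyc_odd[OF ch, of u] cyc simp del: length_append)
  then have par: "even (length A) = even (length B)" "even (length A) = even (length C)"
    by auto
  have key: False
    if "seg_edges u X v \<subseteq> E" "seg_edges u Y v \<subseteq> E" "seg_edges u Z v \<subseteq> E"
      "distinct (u # v # X @ Y @ Z)" "even (length X) = even (length Y)" "even (length X) = even (length Z)"
      "length Y \<ge> 2" "length Z \<ge> 2" for X Y Z
  proof -
    \<comment> \<open>\<open>p\<close> and \<open>q\<close> are the two pairs over
      \<open>{1, 2}\<close> that constant lists on \<open>X\<close> do not block.\<close>
    define p where "p = (if even (length X) then (1::nat, 2::nat) else (1, 1))"
    define q where "q = (if even (length X) then (2::nat, 1::nat) else (2, 2))"
    have b: "blocked E ({u} \<union> {v} \<union> set X \<union> set Y \<union> set Z)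
      (\<lambda>c. (((c u \<noteq> 1 \<and> c u \<noteq> 2 \<or> c v \<noteq> 1 \<and> c v \<noteq> 2) \<or>
         (if even (length X) then c u = 1 \<and> c v = 1 \<or> c u = 2 \<and> c v = 2
         else c u = 1 \<and> c v = 2 \<or> c u = 2 \<and> c v = 1)) \<or> (c u = fst p \<and> c v = snd p))
           \<or> (c u = fst q \<and> c v = snd q))"
      using that \<open>u \<noteq> v\<close>
      by (intro blocked_Un blocked_vertex blocked_seg blocked_seg_const) (auto simp: p_def q_def)
    have "blocked E ({u} \<union> {v} \<union> set X \<union> set Y \<union> set Z) (\<lambda>_. True)"
      by (rule blocked_mono[OF b]) (simp add: p_def q_def, argo)
    moreover have "{u} \<union> {v} \<union> set X \<union> set Y \<union> set Z \<subseteq> V"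
      using that(1-3)[THEN seg_edges_in_V(3)] seg_edges_in_V(1,2)[OF that(1)] by auto
    ultimately show False
      using ch blocked_not_choosable by blast
  qed
  have l1: "n = 1" if "\<not> n \<ge> 2" "n \<noteq> 0" for n :: nat using that by auto
  have dist': "distinct (u # v # B @ A @ C)" "distinct (u # v # C @ A @ B)"
    using dist by auto
  have "\<not> (length B \<ge> 2 \<and> length C \<ge> 2)"
    using key[of A B C] segs dist par by auto
  moreover have "\<not> (length A \<ge> 2 \<and> length C \<ge> 2)"
    using key[of B A C] segs dist'(1) par by auto
  moreover have "\<not> (length A \<ge> 2 \<and> length B \<ge> 2)"
    using key[of C A B] segs dist'(2) par by auto
  moreover have "length B \<noteq> 0" "length C \<noteq> 0" using ne by auto
  ultimately show ?thesis using par l1[of "length A"] l1[of "length B"] l1[of "length C"]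
    by (metis even_zero odd_one)
qed

text \<open>The lists \<open>{1, 2}\<close> at \<open>u\<close> and \<open>{1, 3}\<close> at
  \<open>v\<close> share just one colour. Hence three of the four pairs are unequal and can be
  blocked by paths with one inner vertex; \<open>X\<close> blocks \<open>(1, 1)\<close>.\<close>

lemma theta_2_2_2_not_choosable:
  assumes "seg_edges u [w1] v \<subseteq> E" "seg_edges u [w2] v \<subseteq> E" "seg_edges u [w3] v \<subseteq> E"
    "seg_edges u X v \<subseteq> E" "distinct (u # v # w1 # w2 # w3 # X)" "length X \<ge> 2"
  shows "\<not> choosable23 V E"
proof -
  have b: "blocked E ({u} \<union> {v} \<union> set [w1] \<union> set [w2] \<union> set [w3] \<union> set X)
      (\<lambda>c. ((((c u \<noteq> 1 \<and> c u \<noteq> 2 \<or> c v \<noteq> 1 \<and> c v \<noteq> 3) \<or> (c u = 1 \<and> c v = 3)) \<or> (c u = 2 \<and> c v = 1))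
        \<or> (c u = 2 \<and> c v = 3)) \<or> (c u = 1 \<and> c v = 1))"
    using assms by (intro blocked_Un blocked_vertex blocked_seg) auto
  have "blocked E ({u} \<union> {v} \<union> set [w1] \<union> set [w2] \<union> set [w3] \<union> set X) (\<lambda>_. True)"
    by (rule blocked_mono[OF b]) argo
  then show ?thesis
    by (rule blocked_not_choosable)
      (use assms(1-4)[THEN seg_edges_in_V(3)] seg_edges_in_V(1,2)[OF assms(1)] in auto)
qed

end

section \<open>Ears and theta subgraphs\<close>

lemma (in simple_graph) edge_sym: "(u, v) \<in> E \<Longrightarrow> (v, u) \<in> E"
  using sym_E by (rule symD)

lemma (in simple_graph) no_loop: "(v, v) \<notin> E"
  using irrefl_E by (simp add: irrefl_def)

text \<open>Minimum degree 2 is stated as the existence of a neighbour other than \<open>p\<close>,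
  so that a walk can go on without turning back; connectedness is stated by cuts. A single isolated
  vertex is no instance and is treated separately.\<close>

locale core_graph = simple_graph +
  assumes deg_ge_2: "v \<in> V \<Longrightarrow> \<exists>w. (v, w) \<in> E \<and> w \<noteq> p"
    and cut_edge: "S \<subseteq> V \<Longrightarrow> S \<noteq> {} \<Longrightarrow> S \<noteq> V \<Longrightarrow> \<exists>x\<in>S. \<exists>y. (x, y) \<in> E \<and> y \<notin> S"
begin

text \<open>A path that leaves \<open>W\<close> and is prolonged without turning back must run into \<open>W\<close> or into itself.\<close>

lemma ear_or_lollipop_extend:
  assumes "w \<in> W" "seg_edges w ps z \<subseteq> E" "distinct (ps @ [z])" "set (ps @ [z]) \<inter> W = {}"
  shows "(\<exists>qs w'. w' \<in> W \<and> w' \<noteq> w \<and> qs \<noteq> [] \<and> seg_edges w qs w' \<subseteq> E \<and> distinct qs \<and> set qs \<inter> W = {})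
    \<or> (\<exists>qs. cyc E w qs \<and> set qs \<inter> W = {})
    \<or> (\<exists>T y B. seg_edges w T y \<subseteq> E \<and> cyc E y B \<and> distinct (T @ y # B) \<and> set (T @ y # B) \<inter> W = {})"
  using assms(2-4)
proof (induction "card V - length ps" arbitrary: ps z rule: less_induct)
  case less
  have inV: "z \<in> V" "set ps \<subseteq> V"
    using seg_edges_in_V[OF less.prems(1)] by auto
  have "card (set (ps @ [z])) \<le> card V"
    using inV by (intro card_mono finite_V) auto
  then have len: "length ps < card V"
    using distinct_card[OF less.prems(2)] by simp
  \<comment> \<open>\<open>last (w # ps)\<close> is the predecessor of \<open>z\<close> on the
    path.\<close>
  obtain z' where z': "(z, z') \<in> E" "z' \<noteq> last (w # ps)"
    using deg_ge_2[OF inV(1)] by blast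
  then have zz': "(z', z) \<in> E" "z' \<noteq> z" using edge_sym no_loop by auto
  have seg': "seg_edges w (ps @ [z]) z' \<subseteq> E"
    using less.prems(1) z'(1) zz'(1) by (auto simp: seg_edges_append)
  consider "z' \<in> W" "z' \<noteq> w" | "z' = w" | "z' \<notin> W" "z' \<in> set ps" | "z' \<notin> W" "z' \<notin> set ps"
    by blast
  then show ?case
  proof cases
    case 1
    then show ?thesis using seg' less.prems by blast
  next
    case 2
    then have "ps \<noteq> []" using z' by auto
    then have "cyc E w (ps @ [z])"
      using seg' less.prems 2 assms(1) by (auto simp: cyc_def Suc_le_eq)
    then show ?thesis using less.prems(3) by blast
  next
    case 3
    then obtain T B where ps: "ps = T @ z' # B" by (meson split_list)
    then have "B \<noteq> []" using z' by auto
    then have "cyc E z' (B @ [z])" "seg_edges w T z' \<subseteq> E"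
      using seg' less.prems 3 ps by (auto simp: cyc_def Suc_le_eq seg_edges_append)
    moreover have "distinct (T @ z' # B @ [z])" "set (T @ z' # B @ [z]) \<inter> W = {}"
      using less.prems ps by auto
    ultimately show ?thesis by blast
  next
    case 4
    show ?thesis
      by (rule less.hyps[of "ps @ [z]" z']) (use seg' less.prems zz' 4 len in auto)
  qed
qed

lemma ear_or_lollipop:
  assumes "w \<in> W" "(w, z) \<in> E" "z \<notin> W"
  shows "(\<exists>qs w'. w' \<in> W \<and> w' \<noteq> w \<and> qs \<noteq> [] \<and> seg_edges w qs w' \<subseteq> E \<and> distinct qs \<and> set qs \<inter> W = {})
    \<or> (\<exists>qs. cyc E w qs \<and> set qs \<inter> W = {})
    \<or> (\<exists>T y B. seg_edges w T y \<subseteq> E \<and> cyc E y B \<and> distinct (T @ y # B) \<and> set (T @ y # B) \<inter> W = {})"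
  by (rule ear_or_lollipop_extend[of w W "[]" z]) (use assms edge_sym in auto)

text \<open>With \<open>W = {w}\<close> an ear would need a second vertex of \<open>W\<close>; the
  other two outcomes contain a cycle.\<close>

lemma ex_cyc:
  assumes "V \<noteq> {}"
  shows "\<exists>x A. cyc E x A"
proof -
  obtain w z where "w \<in> V" "(w, z) \<in> E" "z \<noteq> w"
    using assms deg_ge_2 by blast
  then show ?thesis using ear_or_lollipop[of w "{w}" z] by blast
qed

text \<open>By connectedness an edge leaves \<open>W\<close>. If prolonging it gave no ear, it would
  run into a cycle, which together with the cycle through \<open>w\<close> inside \<open>W\<close>
  forms two cycles sharing a vertex or joined by a path.\<close>

lemma ex_ear:
  assumes ch: "choosable23 V E" and "W \<subseteq> V" "W \<noteq> {}" "W \<noteq> V"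
    and cyc: "\<And>w. w \<in> W \<Longrightarrow> \<exists>A. cyc E w A \<and> set A \<subseteq> W"
  shows "\<exists>w qs w'. w \<in> W \<and> w' \<in> W \<and> w \<noteq> w' \<and> qs \<noteq> [] \<and> seg_edges w qs w' \<subseteq> E \<and>
    distinct qs \<and> set qs \<inter> W = {}"
proof -
  obtain w z where w: "w \<in> W" "(w, z) \<in> E" "z \<notin> W"
    using cut_edge[of W] assms by blast
  obtain A where A: "cyc E w A" "set A \<subseteq> W" using cyc w by blast
  have "\<not> (cyc E w qs \<and> set qs \<inter> W = {})" for qs
    using two_cycs_not_choosable[of w A qs] A ch by blast
  moreover have "\<not> (seg_edges w T y \<subseteq> E \<and> cyc E y B \<and> distinct (T @ y # B) \<and> set (T @ y # B) \<inter> W = {})"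
    for T y B
  proof
    assume *: "seg_edges w T y \<subseteq> E \<and> cyc E y B \<and> distinct (T @ y # B) \<and> set (T @ y # B) \<inter> W = {}"
    then have "distinct (w # A @ T @ y # B)"
      using A w(1) by (auto simp: cyc_def)
    then show False
      using two_cycs_tail_not_choosable[of w A T y B] A * ch by blast
  qed
  ultimately show ?thesis using ear_or_lollipop[OF w] w(1) by metis
qed

section \<open>Ears attached to a theta subgraph\<close>

text \<open>A subgraph theta_{2,2,2m}, not necessarily induced, with 2m =
  \<open>length X + 1\<close>. If \<open>length X = 1\<close> it is K_{2,3}, and the three middle
  vertices are interchangeable.\<close>

definition theta :: "'a \<Rightarrow> 'a \<Rightarrow> 'a \<Rightarrow> 'a \<Rightarrow> 'a list \<Rightarrow> bool" where
  "theta u v w1 w2 X \<longleftrightarrow>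
     seg_edges u [w1] v \<subseteq> E \<and> seg_edges u [w2] v \<subseteq> E \<and> seg_edges u X v \<subseteq> E \<and>
     distinct (u # v # w1 # w2 # X) \<and> odd (length X)"

lemma theta_swap_middle: "theta u v w1 w2 X \<Longrightarrow> theta u v w2 w1 X"
  by (auto simp: theta_def)

lemma theta_swap_ends: "theta u v w1 w2 X \<Longrightarrow> theta v u w1 w2 (rev X)"
  by (auto simp: theta_def seg_edges_rev)

text \<open>Only \<open>A\<close> is allowed to be empty, and the conclusion
  \<open>A \<noteq> []\<close> rules out an edge between the ends beside the two other paths. The
  ear lemmas use it with \<open>A = []\<close> to reach the contradiction
  \<open>[] \<noteq> []\<close>.\<close>

lemma theta_from_segs:
  assumes ch: "choosable23 V E" and "u \<noteq> v"
    and segs: "seg_edges u A v \<subseteq> E" "seg_edges u B v \<subseteq> E" "seg_edges u C v \<subseteq> E"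
    and dist: "distinct (u # v # A @ B @ C)" and ne: "B \<noteq> []" "C \<noteq> []"
  shows "A \<noteq> [] \<and> (\<exists>w1 w2 X. theta u v w1 w2 X)"
proof -
  have *: "odd (length A) \<and> odd (length B) \<and> odd (length C) \<and>
    (length A = 1 \<and> length B = 1 \<or> length A = 1 \<and> length C = 1 \<or> length B = 1 \<and> length C = 1)"
    using choosable_theta assms by blast
  have th: "\<exists>w1 w2 X. theta u v w1 w2 X"
    if "seg_edges u X v \<subseteq> E" "seg_edges u Y v \<subseteq> E" "seg_edges u Z v \<subseteq> E"
      "distinct (u # v # X @ Y @ Z)" "odd (length Z)" "length X = 1" "length Y = 1" for X Y Z
  proof -
    obtain x y where "X = [x]" "Y = [y]"
      using \<open>length X = 1\<close> \<open>length Y = 1\<close> by (metis One_nat_def length_0_conv length_Suc_conv)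
    then show ?thesis using that unfolding theta_def by fastforce
  qed
  have "distinct (u # v # A @ C @ B)" "distinct (u # v # B @ C @ A)" using dist by auto
  then have "\<exists>w1 w2 X. theta u v w1 w2 X"
    using * th[of A B C] th[of A C B] th[of B C A] segs dist by blast
  then show ?thesis using * by (auto elim: oddE)
qed

text \<open>Between the neighbours \<open>u\<close> and \<open>w1\<close> there would be two further
  paths: through \<open>w2\<close> and the ear, and through \<open>X\<close> and
  \<open>v\<close>.\<close>

lemma theta_no_middle_ear:
  assumes "choosable23 V E" "theta u v w1 w2 X"
    "seg_edges w1 qs w2 \<subseteq> E" "distinct qs" "set qs \<inter> ({u, v, w1, w2} \<union> set X) = {}"
  shows False
proof -
  have "[] \<noteq> ([]::'a list) \<and> (\<exists>y1 y2 Y. theta u w1 y1 y2 Y)"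
    by (rule theta_from_segs[of _ _ _ "w2 # rev qs" "X @ [v]"])
      (use assms in \<open>auto simp: theta_def seg_edges_append seg_edges_rev\<close>)
  then show False by blast
qed

text \<open>Besides their edge, \<open>u\<close> and \<open>w1\<close> would be joined by the path
  through \<open>w2\<close> and \<open>v\<close> and by the ear. The ear may run through vertices of
  \<open>X\<close>; this covers ears that continue along a part of \<open>X\<close>.\<close>

lemma theta_no_end_middle_ear:
  assumes "choosable23 V E" "theta u v w1 w2 X"
    "seg_edges u qs w1 \<subseteq> E" "distinct qs" "qs \<noteq> []" "set qs \<inter> {u, v, w1, w2} = {}"
  shows False
proof -
  have "[] \<noteq> ([]::'a list) \<and> (\<exists>y1 y2 Y. theta u w1 y1 y2 Y)"
    by (rule theta_from_segs[of _ _ _ "[w2, v]" qs])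
      (use assms in \<open>auto simp: theta_def\<close>)
  then show False by blast
qed

text \<open>Prolonged from \<open>x\<close> along \<open>X1\<close> to \<open>u\<close>, the ear
  becomes one between \<open>u\<close> and \<open>w1\<close>.\<close>

lemma theta_no_middle_path_ear:
  assumes "choosable23 V E" "theta u v w1 w2 (X1 @ x # X2)"
    "seg_edges w1 qs x \<subseteq> E" "distinct qs" "set qs \<inter> ({u, v, w1, w2, x} \<union> set X1 \<union> set X2) = {}"
  shows False
  by (rule theta_no_end_middle_ear[of u v w1 w2 "X1 @ x # X2" "X1 @ x # rev qs"])
    (use assms in \<open>auto simp: theta_def seg_edges_append seg_edges_rev\<close>)

lemma theta_cyc_end:
  assumes "theta u v w1 w2 X"
  shows "cyc E u [w1, v, w2]"
  using assms by (auto simp: theta_def cyc_def)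

text \<open>The ear and the part of \<open>X\<close> from \<open>u\<close> to \<open>x\<close> would
  form a cycle that meets the 4-cycle on \<open>u\<close>, \<open>w1\<close>, \<open>v\<close>,
  \<open>w2\<close> only in \<open>u\<close>. The remaining case is that the ear is the first edge
  of the path through \<open>X\<close>.\<close>

lemma theta_end_path_ear:
  assumes "choosable23 V E" "theta u v w1 w2 (X1 @ x # X2)"
    "seg_edges u qs x \<subseteq> E" "distinct qs" "set qs \<inter> ({u, v, w1, w2, x} \<union> set X1 \<union> set X2) = {}"
  shows "qs = [] \<and> X1 = []"
proof (rule ccontr)
  assume "\<not> (qs = [] \<and> X1 = [])"
  then have "cyc E u (X1 @ x # rev qs)"
    using assms by (auto simp: theta_def cyc_def seg_edges_append seg_edges_rev Suc_le_eq)
  moreover have "set [w1, v, w2] \<inter> set (X1 @ x # rev qs) = {}"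
    using assms by (auto simp: theta_def)
  ultimately show False
    using two_cycs_not_choosable[OF theta_cyc_end[OF assms(2)]] assms(1) by blast
qed

text \<open>The ear and the part of \<open>X\<close> between \<open>x\<close> and \<open>y\<close>
  would form a cycle that \<open>X1\<close> joins to the 4-cycle on \<open>u\<close>,
  \<open>w1\<close>, \<open>v\<close>, \<open>w2\<close>.\<close>

lemma theta_path_path_ear:
  assumes "choosable23 V E" "theta u v w1 w2 (X1 @ x # X2 @ y # X3)"
    "seg_edges x qs y \<subseteq> E" "distinct qs"
    "set qs \<inter> ({u, v, w1, w2, x, y} \<union> set X1 \<union> set X2 \<union> set X3) = {}"
  shows "qs = [] \<and> X2 = []"
proof (rule ccontr)
  assume "\<not> (qs = [] \<and> X2 = [])"
  then have c: "cyc E x (X2 @ y # rev qs)"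
    using assms by (auto simp: theta_def cyc_def seg_edges_append seg_edges_rev Suc_le_eq)
  have "seg_edges u X1 x \<subseteq> E" "distinct (u # [w1, v, w2] @ X1 @ x # X2 @ y # rev qs)"
    using assms by (auto simp: theta_def seg_edges_append)
  then show False
    using two_cycs_tail_not_choosable[OF theta_cyc_end[OF assms(2)] _ c] assms(1) by blast
qed

text \<open>Since \<open>X\<close> has more than one vertex, the parity and length conditions force
  the ear to have a single inner vertex. It is then a third path of length 2 beside the long path
  through \<open>X\<close>.\<close>

lemma theta_end_end_ear:
  assumes "choosable23 V E" "theta u v w1 w2 X" "length X \<noteq> 1"
    "seg_edges u qs v \<subseteq> E" "distinct qs" "set qs \<inter> ({u, v, w1, w2} \<union> set X) = {}"
  shows False
proof -
  have "X \<noteq> []" using assms(2) by (auto simp: theta_def)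
  then have "odd (length qs) \<and> odd (length [w1]) \<and> odd (length X) \<and> (length qs = 1 \<and> length [w1] = 1 \<or>
      length qs = 1 \<and> length X = 1 \<or> length [w1] = 1 \<and> length X = 1)"
    using assms by (intro choosable_theta) (auto simp: theta_def)
  then obtain q where "qs = [q]" using assms(3)
    by (metis One_nat_def length_0_conv length_Suc_conv)
  moreover have "length X \<ge> 2" using \<open>X \<noteq> []\<close> assms(3)
    by (metis One_nat_def Suc_1 Suc_leI length_0_conv less_one linorder_neqE_nat)
  ultimately show False
    using theta_2_2_2_not_choosable[of u w1 v w2 q X] assms by (auto simp: theta_def)
qed

end

section \<open>The choosable cores\<close>

context core_graph begin

lemma cyc_through:
  assumes "cyc E x A" "y \<in> insert x (set A)"
  shows "\<exists>B. cyc E y B \<and> insert y (set B) = insert x (set A) \<and> seg_edges y B y = seg_edges x A x"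
proof (cases "y = x")
  case False
  then obtain A1 A2 where A: "A = A1 @ y # A2"
    using assms(2) by (auto dest: split_list)
  show ?thesis
    by (rule exI[of _ "A2 @ x # A1"]) (use assms(1) A cyc_rotate in \<open>auto simp: seg_edges_append\<close>)
qed (use assms in blast)

text \<open>\<open>qs\<close> may be empty, so the notion includes chords and also the edges that
  already belong to the subgraph on \<open>W\<close>.\<close>

definition ear :: "'a set \<Rightarrow> 'a \<Rightarrow> 'a list \<Rightarrow> 'a \<Rightarrow> bool" where
  "ear W p qs q \<longleftrightarrow> p \<in> W \<and> q \<in> W \<and> p \<noteq> q \<and> seg_edges p qs q \<subseteq> E \<and> distinct qs \<and> set qs \<inter> W = {}"

lemma ear_rev: "ear W p qs q \<Longrightarrow> ear W q (rev qs) p"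
  by (auto simp: ear_def seg_edges_rev)

text \<open>Without ears that have inner vertices, \<open>ex_ear\<close> forces
  \<open>V = W\<close>; then each edge is an ear with empty \<open>qs\<close> and lies in
  \<open>F\<close>.\<close>

lemma graph_eq_if_no_ear:
  assumes ch: "choosable23 V E" and "W \<noteq> {}" "W \<subseteq> V" "F \<subseteq> E"
    and cyc: "\<And>w. w \<in> W \<Longrightarrow> \<exists>x A. cyc E x A \<and> w \<in> insert x (set A) \<and> insert x (set A) \<subseteq> W"
    and no_ear: "\<And>p qs q. ear W p qs q \<Longrightarrow> qs = [] \<and> (p, q) \<in> F"
  shows "V = W \<and> E = F"
proof -
  have "\<exists>A. cyc E w A \<and> set A \<subseteq> W" if "w \<in> W" for w
    using cyc[OF that] cyc_through by (metis insert_subset)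
  then have VW: "V = W"
    using ex_ear[OF ch assms(3,2)] no_ear unfolding ear_def by metis
  moreover have "E \<subseteq> F"
  proof (rule subrelI)
    fix p q assume "(p, q) \<in> E"
    then have "ear W p [] q"
      using E_subset VW edge_sym no_loop by (auto simp: ear_def)
    then show "(p, q) \<in> F" using no_ear by blast
  qed
  ultimately show ?thesis using \<open>F \<subseteq> E\<close> by blast
qed

text \<open>The ear and the two arcs of the cycle between its ends are three paths, which yield a
  theta subgraph unless two of them are single edges. Both arcs cannot be single edges, so the ear
  is an edge and coincides with an arc.\<close>

lemma cycle_graph_eq:
  assumes ch: "choosable23 V E" and c: "cyc E x A" and no_theta: "\<And>u v w1 w2 X. \<not> theta u v w1 w2 X"
  shows "V = insert x (set A) \<and> E = seg_edges x A x"
proof (rule graph_eq_if_no_ear[OF ch])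
  show "insert x (set A) \<subseteq> V" "seg_edges x A x \<subseteq> E"
    using c cyc_in_V by (auto simp: cyc_def)
  fix p qs q assume e: "ear (insert x (set A)) p qs q"
  obtain B where B: "cyc E p B" "insert p (set B) = insert x (set A)" "seg_edges p B p = seg_edges x A x"
    using cyc_through[OF c, of p] e by (auto simp: ear_def)
  then obtain B1 B2 where B12: "B = B1 @ q # B2"
    using e by (metis ear_def insertE split_list)
  have segs: "seg_edges p qs q \<subseteq> E" "seg_edges p B1 q \<subseteq> E" "seg_edges p (rev B2) q \<subseteq> E"
    using B(1) B12 e by (auto simp: ear_def cyc_def seg_edges_append seg_edges_rev)
  have dist: "distinct (p # q # qs @ B1 @ B2)"
    using B(1,2) B12 e by (auto simp: ear_def cyc_def)
  have "B1 = [] \<or> B2 = []"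
    using theta_from_segs[OF ch _ segs] dist no_theta by auto
  moreover have "B1 \<noteq> [] \<or> B2 \<noteq> []" using B(1) B12 by (auto simp: cyc_def)
  moreover have "qs = []" if "B1 = []" "B2 \<noteq> []"
    using theta_from_segs[OF ch _ segs(2,1,3)] dist that no_theta by auto
  moreover have "qs = []" if "B2 = []" "B1 \<noteq> []"
    using theta_from_segs[OF ch _ segs(3,1,2)] dist that no_theta by auto
  ultimately show "qs = [] \<and> (p, q) \<in> seg_edges x A x"
    unfolding B(3)[symmetric] B12 by (auto simp: seg_edges_append)
qed (use c in auto)

definition theta_edges :: "'a \<Rightarrow> 'a \<Rightarrow> 'a \<Rightarrow> 'a \<Rightarrow> 'a list \<Rightarrow> 'a rel" where
  "theta_edges u v w1 w2 X = seg_edges u [w1] v \<union> seg_edges u [w2] v \<union> seg_edges u X v"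

text \<open>The positions of the two ends of an ear are run through; the ear lemmas and the
  symmetries of the theta graph cover all of them. The pair \<open>u\<close>, \<open>v\<close> needs
  \<open>length X \<noteq> 1\<close>, as K_{2,3} can grow to a larger K_{2,n}.\<close>

lemma theta_graph_eq:
  assumes ch: "choosable23 V E" and th: "theta u v w1 w2 X" and len: "length X \<noteq> 1"
  shows "V = {u, v, w1, w2} \<union> set X \<and> E = theta_edges u v w1 w2 X"
proof (rule graph_eq_if_no_ear[OF ch])
  let ?W = "{u, v, w1, w2} \<union> set X" and ?F = "theta_edges u v w1 w2 X"
  define ok where "ok p q \<longleftrightarrow> (\<forall>qs. ear ?W p qs q \<longrightarrow> qs = [] \<and> (p, q) \<in> ?F)" for p q
  have symF: "(q, p) \<in> ?F" if "(p, q) \<in> ?F" for p q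
  proof -
    have "(q, p) \<in> seg_edges a ps b" if "(p, q) \<in> seg_edges a ps b" for a b ps
      using that by (induction ps arbitrary: a) auto
    then show ?thesis using that by (auto simp: theta_edges_def simp del: seg_edges.simps)
  qed
  have ok_sym: "ok q p" if "ok p q" for p q
    using that ear_rev symF unfolding ok_def by (metis rev_is_Nil_conv)
  note [simp] = ok_def theta_edges_def seg_edges_append ear_def
  note th2 = theta_swap_middle[OF th] and th3 = theta_swap_ends[OF th]
    and th4 = theta_swap_ends[OF theta_swap_middle[OF th]]
  have "ok u v" using theta_end_end_ear[OF ch th len] by auto
  moreover have "ok w1 w2" using theta_no_middle_ear[OF ch th] by auto
  moreover have "ok u w1" using theta_no_end_middle_ear[OF ch th] by auto
  moreover have "ok u w2" using theta_no_end_middle_ear[OF ch th2] by auto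
  moreover have "ok v w1" using theta_no_end_middle_ear[OF ch th3] by auto
  moreover have "ok v w2" using theta_no_end_middle_ear[OF ch th4] by auto
  moreover have "ok w1 x" "ok w2 x" "ok u x" "ok v x" if x: "x \<in> set X" for x
  proof -
    obtain X1 X2 where X: "X = X1 @ x # X2" using x by (meson split_list)
    have Xr: "rev X = rev X2 @ x # rev X1" using X by simp
    show "ok w1 x" using theta_no_middle_path_ear[OF ch th[unfolded X]] X by auto
    show "ok w2 x" using theta_no_middle_path_ear[OF ch th2[unfolded X]] X by auto
    show "ok u x" unfolding ok_def
    proof (intro allI impI)
      fix qs assume "ear ?W u qs x"
      then have "qs = [] \<and> X1 = []" using X by (intro theta_end_path_ear[OF ch th[unfolded X]]) auto
      then show "qs = [] \<and> (u, x) \<in> ?F" using X by simp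
    qed
    show "ok v x" unfolding ok_def
    proof (intro allI impI)
      fix qs assume "ear ?W v qs x"
      then have "qs = [] \<and> rev X2 = []" using X by (intro theta_end_path_ear[OF ch th3[unfolded Xr]]) auto
      then show "qs = [] \<and> (v, x) \<in> ?F" using X by simp
    qed
  qed
  moreover have "ok x y" if x: "x \<in> set X" and y: "y \<in> set X" "x \<noteq> y" for x y
  proof -
    have one: "ok x y" if X: "X = X1 @ x # X2 @ y # X3" for x y X1 X2 X3
    unfolding ok_def
    proof (intro allI impI)
      fix qs assume "ear ?W x qs y"
      then have "qs = [] \<and> X2 = []" using X by (intro theta_path_path_ear[OF ch th[unfolded X]]) auto
      then show "qs = [] \<and> (x, y) \<in> ?F" using X by simp
    qed
    obtain X1 X2 where X: "X = X1 @ x # X2" using \<open>x \<in> set X\<close> by (meson split_list)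
    then consider "y \<in> set X1" | "y \<in> set X2" using y by auto
    then show ?thesis
    proof cases
      case 1
      then obtain Y1 Y2 where "X1 = Y1 @ y # Y2" by (meson split_list)
      then have "X = Y1 @ y # Y2 @ x # X2" using X by simp
      then show ?thesis using one ok_sym by blast
    next
      case 2
      then obtain Y1 Y2 where "X2 = Y1 @ y # Y2" by (meson split_list)
      then show ?thesis using one X by blast
    qed
  qed
  ultimately have "ok p q" if "p \<in> ?W" "q \<in> ?W" "p \<noteq> q" for p q
    using that ok_sym by (elim UnE insertE emptyE) blast+
  then show "qs = [] \<and> (p, q) \<in> ?F" if "ear ?W p qs q" for p qs q
    using that unfolding ok_def by (metis ear_def)
  have c1: "cyc E u [w1, v, w2]" by (rule theta_cyc_end[OF th])
  have c2: "cyc E u (X @ [v, w1])"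
    using th by (auto simp: theta_def cyc_def)
  show "\<exists>x A. cyc E x A \<and> w \<in> insert x (set A) \<and> insert x (set A) \<subseteq> ?W" if "w \<in> ?W" for w
  proof (cases "w \<in> set X")
    case True
    then show ?thesis using c2 by (intro exI[of _ u] exI[of _ "X @ [v, w1]"]) auto
  next
    case False
    then show ?thesis using c1 that by (intro exI[of _ u] exI[of _ "[w1, v, w2]"]) auto
  qed
  show "?W \<subseteq> V" using c1 c2 cyc_in_V by fastforce
  show "?F \<subseteq> E" using th by (auto simp: theta_def)
qed simp

text \<open>Any three members of \<open>N\<close> are the middle vertices of a K_{2,3}, so the ear
  lemmas apply to ends anywhere in \<open>N\<close>.\<close>

lemma complete_bipartite_eq:
  assumes ch: "choosable23 V E" and th: "theta u v w1 w2 [w3]"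
    and N: "N = {w. (u, w) \<in> E \<and> (v, w) \<in> E}"
  shows "V = {u, v} \<union> N \<and> E = {u, v} \<times> N \<union> N \<times> {u, v}"
proof (rule graph_eq_if_no_ear[OF ch])
  let ?W = "{u, v} \<union> N" and ?F = "{u, v} \<times> N \<union> N \<times> {u, v}"
  define ok where "ok p q \<longleftrightarrow> (\<forall>qs. ear ?W p qs q \<longrightarrow> qs = [] \<and> (p, q) \<in> ?F)" for p q
  have ok_sym: "ok q p" if "ok p q" for p q
    using that ear_rev unfolding ok_def by (metis (no_types, lifting) Un_iff mem_Sigma_iff rev_is_Nil_conv)
  have w: "w1 \<in> N" "w2 \<in> N" "w3 \<in> N" "w1 \<noteq> w2" "w1 \<noteq> w3" "w2 \<noteq> w3" and uv: "u \<noteq> v"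
    using th N by (auto simp: theta_def)
  have uvN: "u \<notin> N" "v \<notin> N" using no_loop N by auto
  have theta_N: "theta u v a b [c]" if "a \<in> N" "b \<in> N" "c \<in> N" "a \<noteq> b" "b \<noteq> c" "a \<noteq> c" for a b c
    using that N uv uvN edge_sym by (auto simp: theta_def)
  have third: "\<exists>c\<in>N. c \<noteq> a \<and> c \<noteq> b" for a b using w by metis
  have "ok u v"
  unfolding ok_def
    proof (intro allI impI)
    fix qs assume e: "ear ?W u qs v"
    have segs: "seg_edges u [w1] v \<subseteq> E" "seg_edges u [w2] v \<subseteq> E" "seg_edges u [w3] v \<subseteq> E"
      using th by (auto simp: theta_def)
    have "distinct (u # v # w1 # w2 # w3 # qs)"
      using e th w by (auto simp: theta_def ear_def)
    then have "qs \<noteq> []" "\<not> 2 \<le> length qs"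
      using theta_from_segs[OF ch uv _ segs(1,2), of qs] theta_2_2_2_not_choosable[OF segs, of qs] ch e
      by (auto simp: ear_def)
    \<comment> \<open>The single inner vertex \<open>q\<close> would be a common neighbour of
      \<open>u\<close> and \<open>v\<close>, hence in \<open>N\<close>, although an ear avoids
      \<open>N\<close>.\<close>
    then obtain q where "qs = [q]" by (cases qs; cases "tl qs") auto
    then show "qs = [] \<and> (u, v) \<in> ?F" using e N by (auto simp: ear_def)
  qed
  moreover have "ok a b" if "a \<in> N" "b \<in> N" "a \<noteq> b" for a b
  proof -
    obtain c where c: "c \<in> N" "c \<noteq> a" "c \<noteq> b" using third by blast
    show ?thesis
      using theta_no_middle_ear[OF ch theta_N[of a b c]] that c by (auto simp: ok_def ear_def)
  qed
  moreover have "ok u a" "ok v a" if a: "a \<in> N" for a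
  proof -
    obtain b where b: "b \<in> N" "b \<noteq> a" using third by blast
    obtain c where c: "c \<in> N" "c \<noteq> a" "c \<noteq> b" using third by blast
    have t: "theta u v a b [c]" using theta_N a b c by metis
    have "qs = []" if "ear ?W u qs a" for qs
    proof (rule ccontr)
      assume "qs \<noteq> []"
      then show False
        using theta_no_end_middle_ear[OF ch t, of qs] that a b by (auto simp: ear_def)
    qed
    then show "ok u a" using a by (simp add: ok_def)
    have "qs = []" if "ear ?W v qs a" for qs
    proof (rule ccontr)
      assume "qs \<noteq> []"
      then show False
        using theta_no_end_middle_ear[OF ch theta_swap_ends[OF t], of qs] that a b by (auto simp: ear_def)
    qed
    then show "ok v a" using a by (simp add: ok_def)
  qed
  ultimately have "ok p q" if "p \<in> ?W" "q \<in> ?W" "p \<noteq> q" for p q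
    using that ok_sym by (elim UnE insertE emptyE) blast+
  then show "qs = [] \<and> (p, q) \<in> ?F" if "ear ?W p qs q" for p qs q
    using that unfolding ok_def by (metis ear_def)
  show "\<exists>x A. cyc E x A \<and> w \<in> insert x (set A) \<and> insert x (set A) \<subseteq> ?W" if "w \<in> ?W" for w
  proof -
    have "\<exists>a\<in>N. w \<in> {u, v, a}" using that w(1) by blast
    then obtain a where a: "a \<in> N" "w \<in> {u, v, a}" by blast
    obtain b where b: "b \<in> N" "b \<noteq> a" using third by blast
    obtain c where c: "c \<in> N" "c \<noteq> a" "c \<noteq> b" using third by blast
    have "theta u v a b [c]" using theta_N a b c by metis
    then have "cyc E u [a, v, b]" by (rule theta_cyc_end)
    then show ?thesis using a b by (intro exI[of _ u] exI[of _ "[a, v, b]"]) auto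
  qed
  show "?W \<subseteq> V" using w N E_subset by auto
  show "?F \<subseteq> E" using N edge_sym by auto
qed simp

lemma choosable_core_cases:
  assumes ch: "choosable23 V E" and "V \<noteq> {}"
  shows "(\<exists>x A. V = insert x (set A) \<and> E = seg_edges x A x \<and> distinct (x # A) \<and> 2 \<le> length A \<and> odd (length A))
    \<or> (\<exists>u v w1 w2 X. V = {u, v, w1, w2} \<union> set X \<and> E = theta_edges u v w1 w2 X \<and>
         distinct (u # v # w1 # w2 # X) \<and> odd (length X))
    \<or> (\<exists>u v N. V = {u, v} \<union> N \<and> E = {u, v} \<times> N \<union> N \<times> {u, v} \<and> u \<noteq> v \<and> u \<notin> N \<and> v \<notin> N \<and> 4 \<le> card N)"
proof (cases "\<exists>u v w1 w2 X. theta u v w1 w2 X")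
  case False
  obtain x A where "cyc E x A" using ex_cyc assms by blast
  then show ?thesis
    using False cycle_graph_eq[OF ch, of x A] choosable_cyc_odd[OF ch, of x A]
    unfolding cyc_def by metis
next
  case True
  then obtain u v w1 w2 X where th: "theta u v w1 w2 X" by blast
  show ?thesis
  proof (cases "length X = 1")
    case False
    then show ?thesis using theta_graph_eq[OF ch th] th unfolding theta_def by metis
  next
    case True
    then obtain w3 where X: "X = [w3]" by (metis One_nat_def length_0_conv length_Suc_conv)
    define N where "N = {w. (u, w) \<in> E \<and> (v, w) \<in> E}"
    have eq: "V = {u, v} \<union> N" "E = {u, v} \<times> N \<union> N \<times> {u, v}"
      using complete_bipartite_eq[OF ch th[unfolded X] N_def] by auto
    have sub: "{w1, w2, w3} \<subseteq> N" and card3: "card {w1, w2, w3} = 3" and uv: "u \<noteq> v"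
      using th X by (auto simp: theta_def N_def)
    have uvN: "u \<notin> N" "v \<notin> N" using no_loop N_def by auto
    have "finite N" using finite_V eq by simp
    \<comment> \<open>K_{2,3} is theta_{2,2,2} and falls under the theta case, so the bipartite case
      starts at four vertices in \<open>N\<close>.\<close>
    show ?thesis
    proof (cases "N = {w1, w2, w3}")
      case True
      then have "V = {u, v, w1, w2} \<union> set X" "E = theta_edges u v w1 w2 X"
        unfolding eq X theta_edges_def by auto
      then show ?thesis using th unfolding theta_def by metis
    next
      case False
      then have "3 < card N"
        using psubset_card_mono[of N "{w1, w2, w3}"] sub \<open>finite N\<close> card3 by auto
      then have "4 \<le> card N" by simp
      then show ?thesis using eq uv uvN by metis
    qed
  qed
qed

end

section \<open>Colouring cycles, theta graphs and complete bipartite graphs\<close>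

lemma ex_other_in_pair:
  assumes "card S = 2"
  shows "\<exists>e\<in>S. e \<noteq> p"
  using assms by (metis card_2_iff insertCI)

lemma ex_avoiding_in_pair:
  assumes "card S = 2" "S \<noteq> {p, q}"
  shows "\<exists>e\<in>S. e \<noteq> p \<and> e \<noteq> q"
proof (rule ccontr)
  assume "\<not> ?thesis"
  then have "S \<subseteq> {p, q}" by blast
  moreover have "card {p, q} \<le> 2" by (simp add: card_insert_if)
  ultimately have "S = {p, q}" using assms(1) by (intro card_seteq) auto
  then show False using assms(2) by simp
qed

section \<open>List colourings of paths\<close>

definition path_coloring :: "(nat \<Rightarrow> nat set) \<Rightarrow> nat \<Rightarrow> (nat \<Rightarrow> nat) \<Rightarrow> bool" where
  "path_coloring L n c \<longleftrightarrow> (\<forall>i\<le>n. c i \<in> L i) \<and> (\<forall>i<n. c i \<noteq> c (Suc i))"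

lemma path_coloring_Suc:
  assumes "path_coloring L n c" "b \<in> L (Suc n)" "b \<noteq> c n"
  shows "path_coloring L (Suc n) (c(Suc n := b))"
  using assms by (auto simp: path_coloring_def less_Suc_eq le_Suc_eq)

lemma path_coloring_alternating:
  assumes "\<forall>i\<le>n. L i = {p, q}" "p \<noteq> q"
  shows "path_coloring L n (\<lambda>i. if even i then p else q)"
  using assms by (auto simp: path_coloring_def)

text \<open>While all lists agree, colours just alternate. At the first change some \<open>q\<close>
  of the previous list is missing from the next one; a path coloured to arrive with \<open>q\<close>
  can continue with every colour. This freedom persists, because a list of two always has a colour
  other than the next one.\<close>

lemma path_coloring_dichotomy:
  assumes "\<forall>i\<le>n. card (L i) = 2"
  shows "(\<forall>i\<le>n. L 0 = L i) \<or> (\<exists>a\<in>L 0. \<forall>b\<in>L n. \<exists>c. path_coloring L n c \<and> c 0 = a \<and> c n = b)"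
  using assms
proof (induction n)
  case (Suc n)
  have "(\<forall>i\<le>n. L 0 = L i) \<or> (\<exists>a\<in>L 0. \<forall>b\<in>L n. \<exists>c. path_coloring L n c \<and> c 0 = a \<and> c n = b)"
    using Suc by simp
  then consider "\<forall>i\<le>n. L 0 = L i" "L 0 = L (Suc n)" | "\<forall>i\<le>n. L 0 = L i" "L 0 \<noteq> L (Suc n)"
    | a where "a \<in> L 0" "\<forall>b\<in>L n. \<exists>c. path_coloring L n c \<and> c 0 = a \<and> c n = b"
    by blast
  then show ?case
  proof cases
    case 1
    then show ?thesis by (auto simp: le_Suc_eq)
  next
    case 2
    have "\<not> L 0 \<subseteq> L (Suc n)"
    proof
      assume "L 0 \<subseteq> L (Suc n)"
      moreover have "card (L 0) = card (L (Suc n))" "finite (L (Suc n))"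
        using Suc.prems by (auto intro: card_ge_0_finite)
      ultimately show False using 2(2) card_subset_eq[of "L (Suc n)" "L 0"] by simp
    qed
    then obtain q where q: "q \<in> L 0" "q \<notin> L (Suc n)" by blast
    obtain r where r: "L 0 = {q, r}" "q \<noteq> r"
    proof -
      have "card (L 0) = 2" using Suc.prems by simp
      then obtain y z where "L 0 = {y, z}" "y \<noteq> z" using card_2_iff by metis
      then show ?thesis using that[of y] that[of z] q(1) by (cases "q = y") (simp_all add: insert_commute)
    qed
    \<comment> \<open>The start colour is fixed by parity so that the alternating colouring reaches
      \<open>q\<close> at position \<open>n\<close>.\<close>
    define x y where "x = (if even n then q else r)" and "y = (if even n then r else q)"
    then have xy: "L 0 = {x, y}" "x \<noteq> y" using r by auto
    let ?c = "\<lambda>i::nat. if even i then x else y"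
    have "?c n = q" by (simp add: x_def y_def)
    have "path_coloring L n ?c"
      by (rule path_coloring_alternating) (use 2(1) xy in simp_all)
    have "\<exists>c. path_coloring L (Suc n) c \<and> c 0 = x \<and> c (Suc n) = b" if b: "b \<in> L (Suc n)" for b
    proof -
      have "b \<noteq> ?c n" unfolding \<open>?c n = q\<close> using b q(2) by blast
      then have "path_coloring L (Suc n) (?c(Suc n := b))"
        by (rule path_coloring_Suc[OF \<open>path_coloring L n ?c\<close> b])
      then show ?thesis by (rule_tac exI[of _ "?c(Suc n := b)"]) simp
    qed
    moreover have "x \<in> L 0" using xy(1) by simp
    ultimately show ?thesis by blast
  next
    case 3
    have "\<exists>c. path_coloring L (Suc n) c \<and> c 0 = a \<and> c (Suc n) = b" if b: "b \<in> L (Suc n)" for b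
    proof -
      obtain b' where "b' \<in> L n" "b' \<noteq> b"
        using ex_other_in_pair[of "L n" b] Suc.prems by auto
      then obtain c where "path_coloring L n c" "c 0 = a" "c n \<noteq> b"
        using 3(2) by metis
      then show ?thesis
        using path_coloring_Suc[of L n c b] b by (intro exI[of _ "c(Suc n := b)"]) auto
    qed
    then show ?thesis using 3(1) by blast
  qed
qed auto

lemma choosable23_embed:
  fixes V :: "'a set" and V' :: "'b set"
  assumes ch: "choosable23 V' E'" and inj: "inj_on f V" and fV: "f ` V = V'" and "E \<subseteq> V \<times> V"
    and fE: "\<And>u v. (u, v) \<in> E \<Longrightarrow> (f u, f v) \<in> E'"
  shows "choosable23 V E"
  unfolding choosable23_def
proof (intro allI impI)
  fix L :: "'a \<Rightarrow> nat set" assume L: "\<forall>v\<in>V. L v \<subseteq> {1..3} \<and> card (L v) = 2"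
  let ?g = "the_inv_into V f"
  have L': "\<forall>y\<in>V'. L (?g y) \<subseteq> {1..3} \<and> card (L (?g y)) = 2"
    using L fV the_inv_into_into[OF inj _ subset_refl] by blast
  then obtain c :: "'b \<Rightarrow> nat" where c: "\<forall>(u,v)\<in>E'. c u \<noteq> c v" "\<forall>y\<in>V'. c y \<in> L (?g y)"
    using ch[unfolded choosable23_def, THEN spec[of _ "\<lambda>y. L (?g y)"], THEN mp, OF L'] by blast
  have "c (f v) \<in> L v" if "v \<in> V" for v
    using c(2)[rule_format, of "f v"] that fV the_inv_into_f_f[OF inj that] by auto
  moreover have "\<forall>(u,v)\<in>E. c (f u) \<noteq> c (f v)"
    using c(1) fE by blast
  ultimately show "\<exists>c. (\<forall>(u,v)\<in>E. c u \<noteq> c v) \<and> (\<forall>v\<in>V. c v \<in> L v)"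
    by (intro exI[of _ "c \<circ> f"]) auto
qed

text \<open>The cycle is the path 0, ..., \<open>q - 1\<close> plus a closing edge. If all lists
  agree, alternation works as \<open>q\<close> is even; otherwise the dichotomy gives a colour at 0
  that leaves \<open>q - 1\<close> free to differ from it.\<close>

lemma choosable23_cycle_graph:
  assumes "even q" "q > 0"
  shows "choosable23 (pverts (cycle_graph q)) (parcs (cycle_graph q))"
  unfolding choosable23_def
proof (intro allI impI)
  fix L :: "nat \<Rightarrow> nat set"
  assume L: "\<forall>v\<in>pverts (cycle_graph q). L v \<subseteq> {1..3} \<and> card (L v) = 2"
  then have card: "\<forall>i\<le>q - 1. card (L i) = 2"
    using assms by (auto simp: cycle_graph_def)
  have "\<exists>c. path_coloring L (q - 1) c \<and> c (q - 1) \<noteq> c 0"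
    using path_coloring_dichotomy[OF card]
  proof
    assume eq: "\<forall>i\<le>q - 1. L 0 = L i"
    obtain p r where "L 0 = {p, r}" "p \<noteq> r" using card card_2_iff by (metis le0)
    then have "path_coloring L (q - 1) (\<lambda>i. if even i then p else r)"
      by (intro path_coloring_alternating) (use eq in simp_all)
    moreover have "odd (q - 1)" using assms by simp
    ultimately show ?thesis using \<open>p \<noteq> r\<close> by (intro exI conjI) auto
  next
    assume "\<exists>a\<in>L 0. \<forall>b\<in>L (q - 1). \<exists>c. path_coloring L (q - 1) c \<and> c 0 = a \<and> c (q - 1) = b"
    then obtain a where a: "\<forall>b\<in>L (q - 1). \<exists>c. path_coloring L (q - 1) c \<and> c 0 = a \<and> c (q - 1) = b"
      by blast
    have "card (L (q - 1)) = 2" using card by blast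
    from ex_other_in_pair[OF this, of a] obtain b where b: "b \<in> L (q - 1)" "b \<noteq> a" by blast
    obtain c where "path_coloring L (q - 1) c" "c 0 = a" "c (q - 1) = b"
      using a b(1) by blast
    then show ?thesis using b(2) by (intro exI[of _ c]) simp
  qed
  then obtain c where c: "path_coloring L (q - 1) c" "c (q - 1) \<noteq> c 0" by blast
  have succ: "c i \<noteq> c (Suc i mod q)" if "i < q" for i
  proof (cases "Suc i = q")
    case True
    then show ?thesis using c(2) by auto
  next
    case False
    then show ?thesis using c(1) that by (auto simp: path_coloring_def)
  qed
  have "c i \<noteq> c j" if "(i, j) \<in> parcs (cycle_graph q)" for i j
  proof -
    have "i < q" "j < q" and "j = Suc i mod q \<or> i = Suc j mod q"
      using that by (auto simp: cycle_graph_def)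
    then show ?thesis using succ[of i] succ[of j] by fastforce
  qed
  then have "\<forall>(u,v)\<in>parcs (cycle_graph q). c u \<noteq> c v" by blast
  moreover have "\<forall>v\<in>pverts (cycle_graph q). c v \<in> L v"
    using c(1) by (auto simp: path_coloring_def cycle_graph_def)
  ultimately show "\<exists>c. (\<forall>(u,v)\<in>parcs (cycle_graph q). c u \<noteq> c v) \<and> (\<forall>v\<in>pverts (cycle_graph q). c v \<in> L v)"
    by blast
qed

lemma path_coloring_rev:
  assumes "path_coloring (\<lambda>i. L (n - i)) n c"
  shows "path_coloring L n (\<lambda>i. c (n - i))"
  unfolding path_coloring_def
proof (intro conjI allI impI)
  fix i assume "i \<le> n"
  then show "c (n - i) \<in> L i"
    using assms unfolding path_coloring_def by (metis diff_diff_cancel diff_le_self)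
next
  fix i assume "i < n"
  then have "n - Suc i < n" "Suc (n - Suc i) = n - i" by auto
  then show "c (n - i) \<noteq> c (n - Suc i)"
    using assms unfolding path_coloring_def by metis
qed

text \<open>
  If no colouring of the path has equal end colours, then three pairs of end colours extend to
  the path, and they form three different sets, of which \<open>S\<close> and \<open>T\<close> can exclude only two.
\<close>

lemma path_coloring_avoiding:
  assumes L: "\<forall>i\<le>n. L i \<subseteq> {1..3} \<and> card (L i) = 2" and "even n" and "card S = 2" "card T = 2"
  shows "\<exists>c. path_coloring L n c \<and> S \<noteq> {c 0, c n} \<and> T \<noteq> {c 0, c n}"
proof (rule ccontr)
  assume no: "\<not> ?thesis"
  \<comment> \<open>Equal end colours form a singleton, which differs from both \<open>S\<close> and
    \<open>T\<close>.\<close>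
  have diff: "c 0 \<noteq> c n" if "path_coloring L n c" for c
  proof
    assume "c 0 = c n"
    moreover have "S = {c 0, c n} \<or> T = {c 0, c n}" using no that by blast
    ultimately show False using assms(3,4) by auto
  qed
  have "\<not> (\<forall>i\<le>n. L 0 = L i)"
  proof
    assume eq: "\<forall>i\<le>n. L 0 = L i"
    have "card (L 0) = 2" using L by blast
    then obtain p q where "L 0 = {p, q}" "p \<noteq> q" using card_2_iff by metis
    then have "path_coloring L n (\<lambda>i. if even i then p else q)"
      by (intro path_coloring_alternating) (use eq in simp_all)
    from diff[OF this] show False using \<open>even n\<close> by simp
  qed
  have "\<exists>i\<le>n. L n \<noteq> L (n - i)"
  proof (rule ccontr)
    assume "\<not> ?thesis"
    then have eq: "L n = L i" if "i \<le> n" for i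
      using that by (metis diff_diff_cancel diff_le_self)
    then have "\<forall>i\<le>n. L 0 = L i" by (metis le0)
    then show False using \<open>\<not> (\<forall>i\<le>n. L 0 = L i)\<close> by blast
  qed
  \<comment> \<open>The dichotomy is applied from both ends: \<open>a\<close> at the first is
    compatible with all of \<open>L n\<close>, and \<open>b\<close> at the last with all of
    \<open>L 0\<close>.\<close>
  obtain a b
    where a: "a \<in> L 0" "\<forall>y\<in>L n. \<exists>c. path_coloring L n c \<and> c 0 = a \<and> c n = y"
      and b: "b \<in> L n" "\<forall>x\<in>L 0. \<exists>c. path_coloring (\<lambda>i. L (n - i)) n c \<and> c 0 = b \<and> c n = x"
  proof -
    have "\<forall>i\<le>n. card (L (n - i)) = 2" using L by simp
    from path_coloring_dichotomy[OF this] have "\<exists>b\<in>L n. \<forall>x\<in>L 0. \<exists>c. path_coloring (\<lambda>i. L (n - i)) n c \<and> c 0 = b \<and> c n = x"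
      using \<open>\<exists>i\<le>n. L n \<noteq> L (n - i)\<close> unfolding diff_zero diff_self_eq_0 by blast
    moreover have "\<exists>a\<in>L 0. \<forall>y\<in>L n. \<exists>c. path_coloring L n c \<and> c 0 = a \<and> c n = y"
      using path_coloring_dichotomy[of n L] L \<open>\<not> (\<forall>i\<le>n. L 0 = L i)\<close> by blast
    ultimately show ?thesis using that by blast
  qed
  have b': "\<exists>c. path_coloring L n c \<and> c 0 = x \<and> c n = b" if x: "x \<in> L 0" for x
  proof -
    obtain c where "path_coloring (\<lambda>i. L (n - i)) n c" "c 0 = b" "c n = x"
      using b(2) x by blast
    then show ?thesis
      using path_coloring_rev[of L n c] by (intro exI[of _ "\<lambda>i. c (n - i)"]) simp
  qed
  have "a \<notin> L n" "b \<notin> L 0"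
  proof -
    show "a \<notin> L n"
    proof
      assume "a \<in> L n"
      then obtain c where "path_coloring L n c" "c 0 = a" "c n = a" using a(2) by blast
      then show False using diff by metis
    qed
    show "b \<notin> L 0"
    proof
      assume "b \<in> L 0"
      then obtain c where "path_coloring L n c" "c 0 = b" "c n = b" using b' by blast
      then show False using diff by metis
    qed
  qed
  have card2: "card (L 0) = 2" "card (L n) = 2" using L by blast+
  obtain d where d: "d \<in> L 0" "d \<noteq> a" using ex_other_in_pair[OF card2(1)] by blast
  obtain e where e: "e \<in> L n" "e \<noteq> b" using ex_other_in_pair[OF card2(2)] by blast
  have three: "x = 1 \<or> x = 2 \<or> x = 3" if "x \<in> {1..3}" for x :: nat using that by auto
  have "a = 1 \<or> a = 2 \<or> a = 3" "b = 1 \<or> b = 2 \<or> b = 3" "d = 1 \<or> d = 2 \<or> d = 3" "e = 1 \<or> e = 2 \<or> e = 3"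
    by (intro three; use L a(1) b(1) d(1) e(1) in blast)+
  moreover have "a \<noteq> b" "d \<noteq> b" "a \<noteq> e" using b(1) d(1) e(1) \<open>a \<notin> L n\<close> \<open>b \<notin> L 0\<close> by auto
  \<comment> \<open>Each of \<open>d\<close> and \<open>e\<close> differs from \<open>a\<close> and
    \<open>b\<close>, and there are only three colours. This makes \<open>{a, b}\<close>,
    \<open>{a, d}\<close> and \<open>{d, b}\<close> three different pairs of end colours.\<close>
  ultimately have "d = e" "a \<noteq> b" "d \<noteq> b" using \<open>e \<noteq> b\<close> \<open>d \<noteq> a\<close> by presburger+
  have pairs: "{x, y} = S \<or> {x, y} = T" if "path_coloring L n c" "c 0 = x" "c n = y" for c x y
    using no that by metis
  have aL: "{a, y} = S \<or> {a, y} = T" if y: "y \<in> L n" for y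
  proof -
    obtain c where "path_coloring L n c" "c 0 = a" "c n = y" using a(2) y by blast
    then show ?thesis by (rule pairs)
  qed
  obtain c where "path_coloring L n c" "c 0 = d" "c n = b" using b'[OF d(1)] by blast
  then have "{d, b} = S \<or> {d, b} = T" by (rule pairs)
  moreover have "{a, b} = S \<or> {a, b} = T" "{a, d} = S \<or> {a, d} = T"
    using aL[OF b(1)] aL[OF e(1)] \<open>d = e\<close> by metis+
  moreover have "{a, b} \<noteq> {a, d}" "{a, b} \<noteq> {d, b}" "{a, d} \<noteq> {d, b}"
    using \<open>a \<noteq> b\<close> \<open>d \<noteq> b\<close> d(2) by (auto simp: doubleton_eq_iff)
  ultimately show False by metis
qed

text \<open>The long path is coloured first, so that its end colours do not make up the list of a
  middle vertex; then each middle vertex has a colour left.\<close>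

lemma choosable23_theta_graph:
  assumes "m \<ge> 1"
  shows "choosable23 (pverts (theta_graph 2 2 (2 * m))) (parcs (theta_graph 2 2 (2 * m)))"
  unfolding choosable23_def
proof (intro allI impI)
  fix L :: "theta_vertex \<Rightarrow> nat set"
  let ?P = "theta_path 2 (2 * m)"
  assume L: "\<forall>v\<in>pverts (theta_graph 2 2 (2 * m)). L v \<subseteq> {1..3} \<and> card (L v) = 2"
  have "Inner 0 1 = theta_path 0 2 1" "Inner 1 1 = theta_path 1 2 1"
    by (auto simp: theta_path_def)
  then have "Inner 0 1 \<in> theta_path 0 2 ` {..2}" "Inner 1 1 \<in> theta_path 1 2 ` {..2}"
    by auto
  then have w: "card (L (Inner 0 1)) = 2" "card (L (Inner 1 1)) = 2"
    using L unfolding theta_graph_def by auto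
  have "\<forall>j\<le>2 * m. L (?P j) \<subseteq> {1..3} \<and> card (L (?P j)) = 2"
    using L unfolding theta_graph_def by auto
  then obtain d where d: "path_coloring (\<lambda>j. L (?P j)) (2 * m) d"
    "L (Inner 0 1) \<noteq> {d 0, d (2 * m)}" "L (Inner 1 1) \<noteq> {d 0, d (2 * m)}"
    using path_coloring_avoiding[of "2 * m" "\<lambda>j. L (?P j)" "L (Inner 0 1)" "L (Inner 1 1)"] w by auto
  obtain e0 where e0: "e0 \<in> L (Inner 0 1)" "e0 \<noteq> d 0" "e0 \<noteq> d (2 * m)"
    using ex_avoiding_in_pair w(1) d(2) by metis
  obtain e1 where e1: "e1 \<in> L (Inner 1 1)" "e1 \<noteq> d 0" "e1 \<noteq> d (2 * m)"
    using ex_avoiding_in_pair w(2) d(3) by metis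
  define c where "c x = (case x of End1 \<Rightarrow> d 0 | End2 \<Rightarrow> d (2 * m)
    | Inner i j \<Rightarrow> if i = 0 then e0 else if i = 1 then e1 else d j)" for x
  have cP: "c (?P j) = d j" for j
    by (auto simp: c_def theta_path_def)
  have "c (theta_path i 2 j) \<noteq> c (theta_path i 2 (Suc j))" if "i \<in> {0, 1}" "j < 2" for i j
    using that e0 e1 by (auto simp: c_def theta_path_def)
  moreover have "c (?P j) \<noteq> c (?P (Suc j))" if "j < 2 * m" for j
    unfolding cP using d(1) that by (simp add: path_coloring_def)
  ultimately have "\<forall>(u,v)\<in>parcs (theta_graph 2 2 (2 * m)). c u \<noteq> c v"
    unfolding theta_graph_def theta_path_arcs_def pair_pre_digraph.simps
    by (intro ballI) (elim UnE UN_E insertE emptyE; force)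
  moreover have "c (theta_path i 2 j) \<in> L (theta_path i 2 j)" if "i \<in> {0, 1}" "j \<le> 2" for i j
  proof -
    have "d 0 \<in> L End1" "d (2 * m) \<in> L End2"
      using d(1) assms unfolding path_coloring_def
      by (force simp: theta_path_def dest: spec[of _ 0], force simp: theta_path_def dest: spec[of _ "2 * m"])
    moreover have "j = 0 \<or> j = 1 \<or> j = 2" using that by auto
    ultimately show ?thesis using that e0 e1 by (auto simp: c_def theta_path_def)
  qed
  moreover have "c (?P j) \<in> L (?P j)" if "j \<le> 2 * m" for j
    unfolding cP using d(1) that by (simp add: path_coloring_def)
  ultimately show "\<exists>c. (\<forall>(u,v)\<in>parcs (theta_graph 2 2 (2 * m)). c u \<noteq> c v) \<and>
      (\<forall>v\<in>pverts (theta_graph 2 2 (2 * m)). c v \<in> L v)"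
    by (intro exI[of _ c]) (auto simp: theta_graph_def)
qed

lemma choosable23_complete_bipartite:
  assumes "card U = 2" "U \<inter> N = {}"
  shows "choosable23 (U \<union> N) (U \<times> N \<union> N \<times> U)"
  unfolding choosable23_def
proof (intro allI impI)
  fix L :: "'a \<Rightarrow> nat set" assume L: "\<forall>v\<in>U \<union> N. L v \<subseteq> {1..3} \<and> card (L v) = 2"
  obtain u v where U: "U = {u, v}" "u \<noteq> v" using assms(1) card_2_iff by metis
  have "L u \<inter> L v \<noteq> {}"
  proof
    assume "L u \<inter> L v = {}"
    moreover have Luv: "L u \<subseteq> {1..3}" "L v \<subseteq> {1..3}" "card (L u) = 2" "card (L v) = 2"
      using L U(1) by simp_all
    moreover have "finite (L u)" "finite (L v)" using Luv(1,2) finite_subset by blast+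
    ultimately have "card (L u \<union> L v) = 4" by (simp add: card_Un_disjoint)
    moreover have "card (L u \<union> L v) \<le> card {1..3::nat}" using Luv(1,2) by (intro card_mono) auto
    ultimately show False by simp
  qed
  then obtain p where p: "p \<in> L u" "p \<in> L v" by blast
  have "\<forall>w\<in>N. \<exists>e. e \<in> L w \<and> e \<noteq> p"
    using L ex_other_in_pair[of _ p] by (simp add: Bex_def)
  from bchoice[OF this] obtain e where e: "\<forall>w\<in>N. e w \<in> L w \<and> e w \<noteq> p" by blast
  let ?c = "\<lambda>x. if x \<in> N then e x else p"
  have "x \<notin> N" if "x \<in> U" for x using that assms(2) by blast
  then have "?c x \<noteq> ?c y" "?c y \<noteq> ?c x" if "x \<in> U" "y \<in> N" for x y
    using that e by (simp_all, metis)
  then have "\<forall>(u,v)\<in>U \<times> N \<union> N \<times> U. ?c u \<noteq> ?c v" by blast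
  moreover have "\<forall>v\<in>U \<union> N. ?c v \<in> L v" using e p U(1) by simp
  ultimately show "\<exists>c. (\<forall>(u,v)\<in>U \<times> N \<union> N \<times> U. c u \<noteq> c v) \<and> (\<forall>v\<in>U \<union> N. c v \<in> L v)"
    by (intro exI[of _ ?c] conjI)
qed

section \<open>Digraphs, leaves and isomorphisms\<close>

lemma lk_choosable_2_3_iff: "lk_choosable 2 3 G \<longleftrightarrow> choosable23 (verts G) (arcs_ends G)"
  unfolding lk_choosable_def proper_coloring_def choosable23_def ..

text \<open>Connectedness without walks, in the form of \<open>cut_edge\<close>; it passes easily to
  the graph without a leaf.\<close>

definition cut_connected :: "'a set \<Rightarrow> 'a rel \<Rightarrow> bool" where
  "cut_connected V E \<longleftrightarrow> (\<forall>S. S \<subseteq> V \<longrightarrow> S \<noteq> {} \<longrightarrow> S \<noteq> V \<longrightarrow> (\<exists>x\<in>S. \<exists>y. (x, y) \<in> E \<and> y \<notin> S))"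

lemma simple_graph_of_graph:
  assumes "graph G"
  shows "simple_graph (verts G) (arcs_ends G)"
proof -
  interpret graph G by fact
  show ?thesis
  proof
    show "arcs_ends G \<subseteq> verts G \<times> verts G" using adj_in_verts by auto
    show "sym (arcs_ends G)" using sym_arcs by (simp add: symmetric_def)
    show "irrefl (arcs_ends G)" using adj_not_same by (auto simp: irrefl_def)
  qed simp
qed

lemma out_degree_eq_card_neighbours:
  assumes "graph G"
  shows "out_degree G v = card {w. (v, w) \<in> arcs_ends G}"
proof -
  interpret graph G by fact
  have "inj_on (head G) (out_arcs G v)"
    using no_multi_arcs by (auto simp: inj_on_def arc_to_ends_def)
  moreover have "head G ` out_arcs G v = {w. (v, w) \<in> arcs_ends G}"
    by (auto simp: arcs_ends_conv)
  ultimately show ?thesis unfolding out_degree_def by (metis card_image)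
qed

lemma cut_connected_of_connected:
  assumes "graph G" "Digraph_Component.connected G"
  shows "verts G \<noteq> {}" "cut_connected (verts G) (arcs_ends G)"
proof -
  interpret graph G by fact
  have sc: "strongly_connected (with_proj (mk_symmetric G))"
    using assms(2) unfolding Digraph_Component.connected_def .
  then show "verts G \<noteq> {}" by (simp add: strongly_connected_def)
  have ends: "parcs (mk_symmetric G) = arcs_ends G"
    using arcs_ends_symmetric[OF sym_arcs] by (auto simp: parcs_mk_symmetric arcs_ends_conv)
  show "cut_connected (verts G) (arcs_ends G)"
    unfolding cut_connected_def
  proof (intro allI impI)
    fix S assume S: "S \<subseteq> verts G" "S \<noteq> {}" "S \<noteq> verts G"
    then obtain x y where xy: "x \<in> S" "y \<in> verts G" "y \<notin> S" by blast
    have "x \<rightarrow>\<^sup>*\<^bsub>with_proj (mk_symmetric G)\<^esub> y"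
      using sc xy S by (auto simp: strongly_connected_def)
    then have reach: "(x, y) \<in> (arcs_ends G)\<^sup>*"
      using reachable_rtranclI[of "with_proj (mk_symmetric G)" x y] ends by simp
    then show "\<exists>x\<in>S. \<exists>y. (x, y) \<in> arcs_ends G \<and> y \<notin> S"
      using reach xy(1,3) by (induction rule: rtrancl_induct) auto
  qed
qed

lemma graph_del_vert:
  assumes "graph G"
  shows "graph (pre_digraph.del_vert G v)"
    and "arcs_ends (pre_digraph.del_vert G v) = {(x, y) \<in> arcs_ends G. x \<noteq> v \<and> y \<noteq> v}"
proof -
  interpret graph G by fact
  show ends: "arcs_ends (pre_digraph.del_vert G v) = {(x, y) \<in> arcs_ends G. x \<noteq> v \<and> y \<noteq> v}"
    by (auto simp: arcs_ends_conv pre_digraph.del_vert_simps)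
  show "graph (pre_digraph.del_vert G v)"
  proof
    show "symmetric (pre_digraph.del_vert G v)"
      using sym_arcs unfolding symmetric_def ends sym_def by auto
  qed (use no_multi_arcs no_loops in \<open>auto simp: del_vert_simps arc_to_ends_def\<close>)
qed

section \<open>Removing leaves\<close>

text \<open>If the neighbour \<open>z\<close> of the leaf lies in \<open>S\<close>, the cut
  \<open>insert v S\<close> is used, otherwise \<open>S\<close>; in both cases the edge found avoids
  \<open>v\<close>.\<close>

lemma cut_connected_remove_leaf:
  assumes conn: "cut_connected V E" and "E \<subseteq> V \<times> V" "sym E" and nb: "{w. (v, w) \<in> E} = {z}"
  shows "cut_connected (V - {v}) {(x, y) \<in> E. x \<noteq> v \<and> y \<noteq> v}"
  unfolding cut_connected_def
proof (intro allI impI)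
  fix S assume S: "S \<subseteq> V - {v}" "S \<noteq> {}" "S \<noteq> V - {v}"
  have nbv: "w = z" if "(v, w) \<in> E \<or> (w, v) \<in> E" for w
    using that nb \<open>sym E\<close> by (auto dest: symD)
  have v: "v \<in> V" using nb assms(2) by auto
  show "\<exists>x\<in>S. \<exists>y. (x, y) \<in> {(x, y) \<in> E. x \<noteq> v \<and> y \<noteq> v} \<and> y \<notin> S"
  proof (cases "z \<in> S")
    case True
    have "insert v S \<subseteq> V" "insert v S \<noteq> {}" "insert v S \<noteq> V" using S v by auto
    then obtain x y where "x \<in> insert v S" "(x, y) \<in> E" "y \<notin> insert v S"
      using conn unfolding cut_connected_def by blast
    then show ?thesis using True nbv S by blast
  next
    case False
    have "S \<subseteq> V" "S \<noteq> V" using S v by auto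
    then obtain x y where "x \<in> S" "(x, y) \<in> E" "y \<notin> S"
      using conn S(2) unfolding cut_connected_def by blast
    then show ?thesis using False nbv S by blast
  qed
qed

text \<open>A leaf coloured last need only avoid the colour of \<open>z\<close>. Conversely, a dummy
  list \<open>{1, 2}\<close> at \<open>v\<close> turns a list assignment of the smaller graph into
  one of the larger.\<close>

lemma choosable23_remove_leaf:
  assumes "E \<subseteq> V \<times> V" "sym E" "irrefl E" and nb: "{w. (v, w) \<in> E} = {z}"
  shows "choosable23 (V - {v}) {(x, y) \<in> E. x \<noteq> v \<and> y \<noteq> v} \<longleftrightarrow> choosable23 V E"
proof
  assume ch: "choosable23 (V - {v}) {(x, y) \<in> E. x \<noteq> v \<and> y \<noteq> v}"
  have v: "v \<in> V" using nb assms(1) by auto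
  show "choosable23 V E"
    unfolding choosable23_def
  proof (intro allI impI)
    fix L :: "'a \<Rightarrow> nat set" assume L: "\<forall>v\<in>V. L v \<subseteq> {1..3} \<and> card (L v) = 2"
    then obtain c where c: "\<forall>(x, y)\<in>{(x, y) \<in> E. x \<noteq> v \<and> y \<noteq> v}. c x \<noteq> c y" "\<forall>x\<in>V - {v}. c x \<in> L x"
      using ch unfolding choosable23_def by blast
    have "card (L v) = 2" using L v by blast
    from ex_other_in_pair[OF this, of "c z"] obtain e where e: "e \<in> L v" "e \<noteq> c z" by blast
    have nbv: "w = z" if "(v, w) \<in> E \<or> (w, v) \<in> E" for w
      using that nb \<open>sym E\<close> by (auto dest: symD)
    have "z \<noteq> v" using nb \<open>irrefl E\<close> by (auto simp: irrefl_def)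
    have "(c(v := e)) x \<noteq> (c(v := e)) y" if "(x, y) \<in> E" for x y
      using c(1) that e nbv \<open>z \<noteq> v\<close> by (cases "x = v"; cases "y = v") auto
    moreover have "\<forall>x\<in>V. (c(v := e)) x \<in> L x" using c(2) e by auto
    ultimately show "\<exists>c. (\<forall>(x, y)\<in>E. c x \<noteq> c y) \<and> (\<forall>v\<in>V. c v \<in> L v)" by blast
  qed
next
  assume ch: "choosable23 V E"
  show "choosable23 (V - {v}) {(x, y) \<in> E. x \<noteq> v \<and> y \<noteq> v}"
    unfolding choosable23_def
  proof (intro allI impI)
    fix L :: "'a \<Rightarrow> nat set" assume L: "\<forall>x\<in>V - {v}. L x \<subseteq> {1..3} \<and> card (L x) = 2"
    have "\<forall>x\<in>V. (L(v := {1, 2})) x \<subseteq> {1..3} \<and> card ((L(v := {1, 2})) x) = 2"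
      using L by auto
    then obtain c :: "'a \<Rightarrow> nat" where c: "\<forall>(x, y)\<in>E. c x \<noteq> c y" "\<forall>x\<in>V. c x \<in> (L(v := {1, 2})) x"
      using ch[unfolded choosable23_def, THEN spec[of _ "L(v := {1, 2})"]] by blast
    have "\<forall>x\<in>V - {v}. c x \<in> L x" using c(2) by (metis Diff_iff fun_upd_other singletonI)
    then show "\<exists>c. (\<forall>(x, y)\<in>{(x, y) \<in> E. x \<noteq> v \<and> y \<noteq> v}. c x \<noteq> c y) \<and> (\<forall>x\<in>V - {v}. c x \<in> L x)"
      using c(1) by blast
  qed
qed

text \<open>Each removal leaves the neighbour of the leaf, so the vertex set stays nonempty; the
  invariant holds whatever order of removals is taken.\<close>

lemma remove_leafs_invariant:
  assumes "remove_leaf\<^sup>*\<^sup>* G H" "graph G" "verts G \<noteq> {}" "cut_connected (verts G) (arcs_ends G)"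
  shows "graph H \<and> verts H \<noteq> {} \<and> cut_connected (verts H) (arcs_ends H) \<and>
    (choosable23 (verts H) (arcs_ends H) \<longleftrightarrow> choosable23 (verts G) (arcs_ends G))"
  using assms(1)
proof (induction rule: rtranclp_induct)
  case (step H H')
  then obtain v where v: "v \<in> verts H" "out_degree H v = 1" and H': "H' = pre_digraph.del_vert H v"
    by (auto simp: remove_leaf_def)
  have gH: "graph H" using step by blast
  interpret simple_graph "verts H" "arcs_ends H" by (rule simple_graph_of_graph[OF gH])
  obtain z where z: "{w. (v, w) \<in> arcs_ends H} = {z}"
    using v(2) out_degree_eq_card_neighbours[OF gH] by (metis card_1_singletonE)
  then have "z \<in> verts H - {v}" using E_subset no_loop by auto
  then show ?case
    using step.IH graph_del_vert[OF gH, of v] choosable23_remove_leaf[OF E_subset sym_E irrefl_E z]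
      cut_connected_remove_leaf[OF _ E_subset sym_E z] by (auto simp: H' pre_digraph.verts_del_vert)
qed (use assms in simp)

section \<open>Isomorphisms with the standard graphs\<close>

text \<open>A labelling \<open>g\<close> from the standard graph to \<open>H\<close> is easier to
  give than its inverse. Arcs are sent injectively to pairs of vertices because \<open>H\<close> has
  no parallel arcs.\<close>

lemma digraph_iso_with_projI:
  assumes "graph H" and g: "bij_betw g (pverts P) (verts H)"
    and ends: "arcs_ends H = map_prod g g ` parcs P" and sub: "parcs P \<subseteq> pverts P \<times> pverts P"
  shows "digraph_iso H (with_proj P)"
proof -
  interpret graph H by fact
  let ?f = "the_inv_into (pverts P) g"
  have inj: "inj_on g (pverts P)" and gP: "g ` pverts P = verts H" using g by (auto simp: bij_betw_def)
  have f: "bij_betw ?f (verts H) (pverts P)" by (rule bij_betw_the_inv_into[OF g])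
  have "map_prod ?f ?f ` arcs_ends H = (\<lambda>p. p) ` parcs P"
    unfolding ends image_image
    by (intro image_cong) (use sub inj in \<open>auto simp: the_inv_into_f_f\<close>)
  then have arcs: "(\<lambda>a. (?f (tail H a), ?f (head H a))) ` arcs H = parcs P"
    by (simp add: arcs_ends_conv image_image)
  have "inj_on (\<lambda>a. (?f (tail H a), ?f (head H a))) (arcs H)"
  proof (rule inj_onI)
    fix a b assume ab: "a \<in> arcs H" "b \<in> arcs H"
      "(?f (tail H a), ?f (head H a)) = (?f (tail H b), ?f (head H b))"
    then have "tail H a = tail H b" "head H a = head H b"
      using bij_betw_imp_inj_on[OF f] by (auto dest: inj_onD)
    then show "a = b" using no_multi_arcs[OF ab(1,2)] by (simp add: arc_to_ends_def)
  qed
  then have "digraph_isomorphism \<lparr> iso_verts = ?f, iso_arcs = \<lambda>a. (?f (tail H a), ?f (head H a)),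
      iso_head = snd, iso_tail = fst \<rparr>"
    using bij_betw_imp_inj_on[OF f] wf_digraph by (simp add: digraph_isomorphism_def)
  moreover have "with_proj P = app_iso \<lparr> iso_verts = ?f, iso_arcs = \<lambda>a. (?f (tail H a), ?f (head H a)),
      iso_head = snd, iso_tail = fst \<rparr> H"
    using arcs bij_betw_imp_surj_on[OF f] by (simp add: with_proj_def app_iso_def)
  ultimately show ?thesis unfolding digraph_iso_def by blast
qed

lemma choosable23_of_digraph_iso:
  assumes "graph H" "digraph_iso H (with_proj P)" "choosable23 (pverts P) (parcs P)"
  shows "choosable23 (verts H) (arcs_ends H)"
proof -
  interpret graph H by fact
  obtain h where h: "digraph_isomorphism h" "with_proj P = app_iso h H"
    using assms(2) unfolding digraph_iso_def by blast
  have P: "pverts P = iso_verts h ` verts H" "parcs P = iso_arcs h ` arcs H"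
    "iso_tail h = fst" "iso_head h = snd"
    using h(2) by (auto simp: with_proj_def app_iso_def)
  show ?thesis
  proof (rule choosable23_embed[OF assms(3)])
    show "inj_on (iso_verts h) (verts H)" by (rule digraph_isomorphism_inj_on_verts[OF h(1)])
    show "arcs_ends H \<subseteq> verts H \<times> verts H" using adj_in_verts by auto
    fix u v assume "(u, v) \<in> arcs_ends H"
    then obtain a where a: "a \<in> arcs H" "tail H a = u" "head H a = v" by (auto simp: arcs_ends_conv)
    then have "iso_arcs h a = (iso_verts h u, iso_verts h v)"
      using iso_verts_tail[OF h(1) a(1)] iso_verts_head[OF h(1) a(1)] P(3,4) by (simp add: prod_eq_iff)
    then show "(iso_verts h u, iso_verts h v) \<in> parcs P"
      using imageI[OF a(1), of "iso_arcs h"] P(2) by simp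
  qed (simp add: P)
qed

lemma digraph_iso_cycle_graph:
  assumes "graph H" and V: "verts H = insert x (set A)" and E: "arcs_ends H = seg_edges x A x"
    and dist: "distinct (x # A)"
  shows "digraph_iso H (with_proj (cycle_graph (Suc (length A))))"
proof (rule digraph_iso_with_projI[OF assms(1)])
  let ?q = "Suc (length A)"
  show "bij_betw ((!) (x # A)) (pverts (cycle_graph ?q)) (verts H)"
    using bij_betw_nth[OF dist, of "{..<?q}" "verts H"] V by (simp add: cycle_graph_def)
  show "parcs (cycle_graph ?q) \<subseteq> pverts (cycle_graph ?q) \<times> pverts (cycle_graph ?q)"
    by (auto simp: cycle_graph_def)
  have parcs: "parcs (cycle_graph ?q) = (\<Union>j<?q. {(j, Suc j mod ?q), (Suc j mod ?q, j)})"
    by (auto simp: cycle_graph_def)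
  \<comment> \<open>Position \<open>?q\<close> of the closed walk is \<open>x\<close> again, which
    matches index 0 modulo \<open>?q\<close>.\<close>
  have "(x # A @ [x]) ! j = (x # A) ! j \<and> (x # A @ [x]) ! Suc j = (x # A) ! (Suc j mod ?q)" if "j < ?q" for j
    using that by (cases j; cases "j = length A") (auto simp: nth_append)
  then show "arcs_ends H = map_prod ((!) (x # A)) ((!) (x # A)) ` parcs (cycle_graph ?q)"
    unfolding E seg_edges_nth parcs image_UN by (intro SUP_cong) auto
qed

lemma theta_path_arcs_image:
  assumes "\<And>j. j \<le> Suc (length ps) \<Longrightarrow> g (theta_path i (Suc (length ps)) j) = (u # ps @ [v]) ! j"
  shows "map_prod g g ` theta_path_arcs i (Suc (length ps)) = seg_edges u ps v"
  unfolding theta_path_arcs_def seg_edges_nth image_UN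
  by (intro SUP_cong) (simp_all add: assms del: nth_Cons_Suc)

lemma digraph_iso_theta_graph:
  assumes "graph H" and V: "verts H = {u, v, w1, w2} \<union> set X"
    and E: "arcs_ends H = seg_edges u [w1] v \<union> seg_edges u [w2] v \<union> seg_edges u X v"
    and dist: "distinct (u # v # w1 # w2 # X)"
  shows "digraph_iso H (with_proj (theta_graph 2 2 (Suc (length X))))"
proof (rule digraph_iso_with_projI[OF assms(1)])
  let ?l = "Suc (length X)"
  \<comment> \<open>Inner vertices of a theta path are numbered from 1, hence the index
    \<open>j - 1\<close>.\<close>
  define g where "g t = (case t of End1 \<Rightarrow> u | End2 \<Rightarrow> v
    | Inner i j \<Rightarrow> if i = 0 then w1 else if i = 1 then w2 else X ! (j - 1))" for t
  have P: "pverts (theta_graph 2 2 ?l) = {End1, End2, Inner 0 1, Inner 1 1} \<union> Inner 2 ` {1..<?l}"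
    (is "_ = ?P")
  proof -
    have "theta_path i 2 ` {..2} = {End1, Inner i 1, End2}" for i
    proof -
      have "{..2::nat} = {0, 1, 2}" by auto
      then show ?thesis by (auto simp: theta_path_def)
    qed
    moreover have "theta_path 2 ?l ` {..?l} = {End1, End2} \<union> Inner 2 ` {1..<?l}"
    proof -
      have "{..?l} = {0, ?l} \<union> {1..<?l}" by auto
      moreover have "theta_path 2 ?l ` {1..<?l} = Inner 2 ` {1..<?l}"
        by (intro image_cong) (auto simp: theta_path_def)
      moreover have "theta_path 2 ?l 0 = End1" "theta_path 2 ?l ?l = End2"
        by (auto simp: theta_path_def)
      ultimately show ?thesis by (simp add: image_Un)
    qed
    ultimately show ?thesis unfolding theta_graph_def by auto
  qed
  have img: "(\<lambda>j. X ! (j - 1)) ` {1..<?l} = set X"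
  proof -
    have "{1..<?l} = Suc ` {..<length X}" by (auto simp: image_Suc_lessThan)
    moreover have "set X = (!) X ` {..<length X}" by (auto simp: set_conv_nth)
    ultimately show ?thesis by (simp only: image_image diff_Suc_1)
  qed
  show "bij_betw g (pverts (theta_graph 2 2 ?l)) (verts H)"
  proof (rule bij_betw_imageI)
    show "inj_on g (pverts (theta_graph 2 2 ?l))"
      unfolding P using dist
      by (auto simp: inj_on_def g_def nth_eq_iff_index_eq)
    show "g ` pverts (theta_graph 2 2 ?l) = verts H"
      unfolding P V img[symmetric] by (auto simp: g_def image_Un image_image)
  qed
  have one: "map_prod g g ` theta_path_arcs i 2 = seg_edges u [w] v" if "i = 0 \<and> w = w1 \<or> i = 1 \<and> w = w2" for i w
  proof -
    have "g (theta_path i (Suc (length [w])) j) = (u # [w] @ [v]) ! j" if "j \<le> Suc (length [w])" for j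
    proof -
      have "j = 0 \<or> j = 1 \<or> j = 2" using that by auto
      then show ?thesis using \<open>i = 0 \<and> w = w1 \<or> i = 1 \<and> w = w2\<close> by (auto simp: g_def theta_path_def)
    qed
    from theta_path_arcs_image[OF this] show ?thesis by (simp add: numeral_2_eq_2)
  qed
  have "map_prod g g ` theta_path_arcs 2 ?l = seg_edges u X v"
    by (intro theta_path_arcs_image) (auto simp: g_def theta_path_def nth_Cons nth_append split: nat.splits)
  then show "arcs_ends H = map_prod g g ` parcs (theta_graph 2 2 ?l)"
    using one[of 0 w1] one[of 1 w2] by (simp add: E theta_graph_def image_Un)
  show "parcs (theta_graph 2 2 ?l) \<subseteq> pverts (theta_graph 2 2 ?l) \<times> pverts (theta_graph 2 2 ?l)"
    by (auto simp: theta_graph_def theta_path_arcs_def)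
qed

section \<open>The two directions for cores\<close>

lemma in_T_tilde_imp_choosable23:
  assumes "graph H" "in_T_tilde H"
  shows "choosable23 (verts H) (arcs_ends H)"
proof -
  consider "K\<^bsub>1\<^esub> H" | m where "m \<ge> 1" "digraph_iso H (with_proj (cycle_graph (2 * m + 2)))"
    | m where "m \<ge> 1" "digraph_iso H (with_proj (theta_graph 2 2 (2 * m)))"
    | m where "K\<^bsub>2,m + 3\<^esub> H"
    using assms(2) unfolding in_T_tilde_def by blast
  then show ?thesis
  proof cases
    case 1
    then have card1: "card (verts H) = 1"
      and ends: "arcs_ends H = {(u,v). (u,v) \<in> verts H \<times> verts H \<and> u \<noteq> v}"
      unfolding complete_digraph_def by auto
    obtain v where "verts H = {v}" using card1 by (metis card_1_singletonE)
    then have "arcs_ends H = {}" "verts H = {v}" using ends by auto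
    moreover have "\<exists>c. c v \<in> L v" if "card (L v) = 2" for L :: "'a \<Rightarrow> nat set"
      using ex_other_in_pair[OF that] by (auto intro: exI[of _ "\<lambda>_. _"])
    ultimately show ?thesis unfolding choosable23_def by simp
  next
    case (2 m)
    then show ?thesis
      using choosable23_of_digraph_iso[OF assms(1)] choosable23_cycle_graph[of "2 * m + 2"] by simp
  next
    case (3 m)
    then show ?thesis
      using choosable23_of_digraph_iso[OF assms(1)] choosable23_theta_graph[of m] by simp
  next
    case (4 m)
    then show ?thesis
      unfolding complete_bipartite_digraph_def using choosable23_complete_bipartite by metis
  qed
qed

text \<open>A vertex of degree 0 in a connected core is its only vertex, giving K_1; otherwise all
  degrees are at least 2 and the case distinction in \<open>core_graph\<close> applies.\<close>

lemma choosable23_core_imp_in_T_tilde: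
  assumes gH: "graph H" and "verts H \<noteq> {}" and conn: "cut_connected (verts H) (arcs_ends H)"
    and deg: "\<forall>v\<in>verts H. out_degree H v = 0 \<or> out_degree H v \<ge> 2"
    and ch: "choosable23 (verts H) (arcs_ends H)"
  shows "in_T_tilde H"
proof -
  interpret simple_graph "verts H" "arcs_ends H" by (rule simple_graph_of_graph[OF gH])
  have nb_fin: "finite {w. (v, w) \<in> arcs_ends H}" for v
    by (rule finite_subset[OF _ finite_V]) (use E_subset in auto)
  show ?thesis
  proof (cases "\<exists>v\<in>verts H. out_degree H v = 0")
    case True
    then obtain v where v: "v \<in> verts H" "{w. (v, w) \<in> arcs_ends H} = {}"
      using out_degree_eq_card_neighbours[OF gH] nb_fin by auto
    have V: "verts H = {v}"
    proof (rule ccontr)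
      assume "verts H \<noteq> {v}"
      then obtain y where "(v, y) \<in> arcs_ends H"
        using conn v(1) unfolding cut_connected_def by blast
      then show False using v(2) by blast
    qed
    then have "arcs_ends H = {}" using E_subset no_loop by auto
    then have "K\<^bsub>1\<^esub> H" unfolding complete_digraph_def using gH V by auto
    then show ?thesis unfolding in_T_tilde_def by blast
  next
    case False
    interpret core_graph "verts H" "arcs_ends H"
    proof
      fix v p assume "v \<in> verts H"
      then have "2 \<le> card {w. (v, w) \<in> arcs_ends H}"
        using deg False out_degree_eq_card_neighbours[OF gH] by metis
      then have "\<not> {w. (v, w) \<in> arcs_ends H} \<subseteq> {p}"
        using card_mono[of "{p}" "{w. (v, w) \<in> arcs_ends H}"] by auto
      then show "\<exists>w. (v, w) \<in> arcs_ends H \<and> w \<noteq> p" by blast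
    qed (use conn in \<open>auto simp: cut_connected_def\<close>)
    from choosable_core_cases[OF ch assms(2)] show ?thesis
    proof (elim disjE exE conjE)
      fix x A
      assume cycle: "verts H = insert x (set A)" "arcs_ends H = seg_edges x A x"
        "distinct (x # A)" "2 \<le> length A" "odd (length A)"
      \<comment> \<open>\<open>A\<close> omits one vertex of the cycle, so length
        \<open>2 * m + 1\<close> gives the cycle on \<open>2 * m + 2\<close> vertices;
        \<open>m \<ge> 1\<close> follows from \<open>2 \<le> length A\<close>.\<close>
      obtain m where m: "length A = 2 * m + 1" using cycle(5) by (elim oddE)
      then have "digraph_iso H (with_proj (cycle_graph (2 * m + 2)))" "m \<ge> 1"
        using digraph_iso_cycle_graph[OF gH cycle(1-3)] cycle(4) by simp_all
      then show ?thesis unfolding in_T_tilde_def by blast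
    next
      fix u v w1 w2 X
      assume theta: "verts H = {u, v, w1, w2} \<union> set X" "arcs_ends H = theta_edges u v w1 w2 X"
         "distinct (u # v # w1 # w2 # X)" "odd (length X)"
      obtain m where m: "length X = 2 * m + 1" using theta(4) by (elim oddE)
      then have "digraph_iso H (with_proj (theta_graph 2 2 (2 * (m + 1))))"
        using digraph_iso_theta_graph[OF gH theta(1) _ theta(3)] theta(2)
        unfolding theta_edges_def by simp
      moreover have "m + 1 \<ge> 1" by simp
      ultimately show ?thesis unfolding in_T_tilde_def by blast
    next
      fix u v N
      assume bipartite: "verts H = {u, v} \<union> N" "arcs_ends H = {u, v} \<times> N \<union> N \<times> {u, v}"
         "u \<noteq> v" "u \<notin> N" "v \<notin> N" "4 \<le> card N"
      obtain m where m: "card N = m + 4" using bipartite(6) by (metis add.commute le_Suc_ex)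
      have "{u, v} \<inter> N = {}" "card {u, v} = 2" "card N = (m + 1) + 3"
        using bipartite(3-5) m by auto
      then have "K\<^bsub>2,(m + 1) + 3\<^esub> H"
        unfolding complete_bipartite_digraph_def using gH bipartite(1,2) by blast
      moreover have "m + 1 \<ge> 1" by simp
      ultimately show ?thesis unfolding in_T_tilde_def by blast
    qed
  qed
qed

theorem theorem4p2:
  fixes G H :: "('a,'b) pre_digraph"
  assumes "graph G"
    and "Digraph_Component.connected G"
    and "is_core G H"
  shows "lk_choosable 2 3 G \<longleftrightarrow> in_T_tilde H"
proof -
  have "remove_leaf\<^sup>*\<^sup>* G H" and deg: "\<forall>v\<in>verts H. out_degree H v = 0 \<or> out_degree H v \<ge> 2"
    using assms(3) unfolding is_core_def by auto
  then have H: "graph H" "verts H \<noteq> {}" "cut_connected (verts H) (arcs_ends H)"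
    "choosable23 (verts H) (arcs_ends H) \<longleftrightarrow> lk_choosable 2 3 G"
    using remove_leafs_invariant[of G H] cut_connected_of_connected[OF assms(1,2)] assms(1)
    unfolding lk_choosable_2_3_iff by blast+
  show ?thesis
    using in_T_tilde_imp_choosable23[OF H(1)] choosable23_core_imp_in_T_tilde[OF H(1-3) deg] H(4) by blast
qed

end
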